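(* (Spread option.) In the two-dimensional Black–Scholes model of the context let $H=(S^1_T-S^2_T-K)^+$ with $K>0$. Write $s_1(x)=S^1_0e^{(\alpha_1-\frac12\sigma_1^2)T+\sigma_1x}$, $s_2(y)=S^2_0e^{(\alpha_2-\frac12\sigma_2^2)T+\sigma_2y}$, $\tilde s_1(x)=S^1_0e^{(r-\frac12\sigma_1^2)T+\sigma_1x}$, $\tilde s_2(y)=S^2_0e^{(r-\frac12\sigma_2^2)T+\sigma_2y}$, and $$d(y)=\frac1{\sigma_1}\ln\left(\frac{s_2(y)+K}{S^1_0e^{(\alpha_1-\frac12\sigma_1^2)T}}\right),\qquad\tilde d(y)=\frac1{\sigma_1}\ln\left(\frac{\tilde s_2(y)+K}{S^1_0e^{(r-\frac12\sigma_1^2)T}}\right).$$ (linear loss) For every $c\ge0$ $$\Psi_1(c)=\int_{-\infty}^\infty\int_{d(y)}^\infty(s_1(x)-s_2(y)-K)\mathbf 1_{\{A_1x+A_2y\ge\ln c-BT\}}f_{W^1_T\mid W^2_T=y}(x)\,dx\,f_{W^2_T}(y)\,dy,$$ $$\Psi_2(c)=\int_{-\infty}^\infty\int_{\tilde d(y)}^\infty(\tilde s_1(x)-\tilde s_2(y)-K)\mathbf 1_{\{A_1x+A_2y\ge\ln c-\tilde BT\}}\tilde f_{\widetilde W^1_T\mid\widetilde W^2_T=y}(x)\,dx\,\tilde f_{\widetilde W^2_T}(y)\,dy.$$ (power loss, $p>1$) For $c\ge0$ put $$\mathcal A(y)=\left\{x\ge d(y):\ c^{\frac1{p-1}}e^{-\frac{A_1x+A_2y+BT}{p-1}}\le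 s_1(x)-s_2(y)-K\right\},\quad\mathcal B(y)=\left\{x\ge d(y):\ c^{\frac1{p-1}}e^{-\frac{A_1x+A_2y+BT}{p-1}}> s_1(x)-s_2(y)-K\right\},$$ $$\tilde{\mathcal A}(y)=\left\{x\ge\tilde d(y):\ c^{\frac1{p-1}}e^{-\frac{A_1x+A_2y+\tilde BT}{p-1}}\le\tilde s_1(x)-\tilde s_2(y)-K\right\}.$$ Then $$\Psi^p_1(c)=\frac1p\int_{-\infty}^\infty\int_{\mathcal B(y)}(s_1(x)-s_2(y)-K)^pf_{W^1_T\mid W^2_T=y}(x)\,dx\,f_{W^2_T}(y)\,dy+\frac1pc^{\frac p{p-1}}e^{-\frac{pBT}{p-1}}\int_{-\infty}^\infty\int_{\mathcal A(y)}e^{-\frac{pA_1}{p-1}x-\frac{pA_2}{p-1}y}f_{W^1_T\mid W^2_T=y}(x)\,dx\,f_{W^2_T}(y)\,dy,$$ $$\Psi^p_2(c)=\int_{-\infty}^\infty\int_{\tilde{\mathcal A}(y)}(\tilde s_1(x)-\tilde s_2(y)-K)\tilde f_{\widetilde W^1_T\mid\widetilde W^2_T=y}(x)\,dx\,\tilde f_{\widetilde W^2_T}(y)\,dy-c^{\frac1{p-1}}e^{-\frac{\tilde BT}{p-1}}\int_{-\infty}^\infty\int_{\tilde{\mathcal A}(y)}e^{-\frac{A_1}{p-1}x-\frac{A_2}{p-1}y}\tilde f_{\widetilde W^1_T\mid\widetilde W^2_T=y}(x)\,dx\,\tilde f_{\widetilde W^2_T}(y)\,dy.$$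
   Context: Model. $T>0$; $(W^1,W^2)$ is a Wiener process under $P$ with correlation matrix $Q=\begin{pmatrix}1&\rho\\\rho&1\end{pmatrix}$, $|\rho|<1$. Stocks $dS^i_t=S^i_t(\alpha_i\,dt+\sigma_i\,dW^i_t)$, $i=1,2$, $S^i_0>0$, $\alpha_i\in\mathbb R$, $\sigma_i>0$, interest rate $r$. Let $\theta_i=\frac{\alpha_i-r}{\sigma_i}$, $\theta=(\theta_1,\theta_2)^T$, $\widetilde W^i_t=W^i_t+\theta_it$. The martingale measure $\tilde P$ has density $\tilde Z_T=e^{-A_1W^1_T-A_2W^2_T-BT}=e^{-A_1\widetilde W^1_T-A_2\widetilde W^2_T-\tilde BT}$ with respect to $P$, where $(A_1,A_2)^T=Q^{-1}\theta$, $B=\frac12|Q^{-1/2}\theta|^2$, $\tilde B=B-A_1\theta_1-A_2\theta_2$; under $\tilde P$, $\widetilde W$ is a Wiener process with correlation matrix $Q$. $\mathbf E,\tilde{\mathbf E}$ are expectations under $P,\tilde P$; $f$ denotes (conditional) densities under $P$ and $\tilde f$ under $\tilde P$. Risk auxiliary functions. Linear loss $l(x)=x$: $\Psi_1(c)=\mathbf E[H\mathbf 1_{\{\tilde Z_T^{-1}\ge c\}}]$, $\Psi_2(c)=\tilde{\mathbf E}[H\mathbf 1_{\{\tilde Z_T^{-1}\ge c\}}]$. Power loss $l(x)=x^p/p$, $p>1$: with $\varphi_c:=\left\{1-\left(\frac{(c\tilde Z_T)^{1/(p-1)}}{H}\wedge1\right)\right\}\mathbf 1_{\{H>0\}}$,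 $\Psi^p_1(c)=\frac1p\mathbf E[((1-\varphi_c)H)^p]$ and $\Psi^p_2(c)=\tilde{\mathbf E}[H\varphi_c]$. Convention: $\ln0=-\infty$. *)

theory Defs
  imports "HOL-Probability.Probability"
begin

section \<open>Correlated Wiener processes\<close>

definition corr_matrix :: "real \<Rightarrow> real^2^2" where
  "corr_matrix \<rho> = vector [vector [1, \<rho>], vector [\<rho>, 1]]"

text \<open>The positive semidefinite square root; \<open>Q\<^sup>-\<^sup>1\<^sup>/\<^sup>2\<close> is the one of \<open>Q\<^sup>-\<^sup>1\<close>.\<close>

definition psd_sqrt :: "real^'n^'n \<Rightarrow> real^'n^'n" where
  "psd_sqrt A = (THE R. transpose R = R \<and> (\<forall>x. 0 \<le> x \<bullet> (R *v x)) \<and> R ** R = A)"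

definition mvnormal_density :: "real^'n^'n \<Rightarrow> real^'n \<Rightarrow> real" where
  "mvnormal_density \<Sigma> z =
     exp (- (z \<bullet> (matrix_inv \<Sigma> *v z)) / 2) / sqrt ((2 * pi) ^ CARD('n) * det \<Sigma>)"

definition adapted :: "(real \<Rightarrow> 'a measure) \<Rightarrow> real \<Rightarrow> (real \<Rightarrow> 'a \<Rightarrow> 'b::topological_space) \<Rightarrow> bool" where
  "adapted F T X \<longleftrightarrow> (\<forall>t\<in>{0..T}. X t \<in> borel_measurable (F t))"

definition sub_filtration :: "'a measure \<Rightarrow> (real \<Rightarrow> 'a measure) \<Rightarrow> bool" where
  "sub_filtration M F \<longleftrightarrow> filtration (space M) F \<and> (\<forall>t. sets (F t) \<subseteq> sets M)"

text \<open>A Wiener process on \<open>{0..T}\<close> relative to the filtration \<open>F\<close> (which may be the one the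
  process generates) with invertible correlation matrix \<open>Q\<close>.\<close>

definition wiener_process ::
  "'a measure \<Rightarrow> (real \<Rightarrow> 'a measure) \<Rightarrow> real \<Rightarrow> real^'n^'n \<Rightarrow> (real \<Rightarrow> 'a \<Rightarrow> real^'n) \<Rightarrow> bool" where
  "wiener_process M F T Q W \<longleftrightarrow>
     adapted F T W \<and>
     (AE \<omega> in M. W 0 \<omega> = 0) \<and>
     (AE \<omega> in M. continuous_on {0..T} (\<lambda>t. W t \<omega>)) \<and>
     (\<forall>s t. 0 \<le> s \<and> s < t \<and> t \<le> T \<longrightarrow>
        prob_space.indep_set M (sets (F s))
          {(\<lambda>\<omega>. W t \<omega> - W s \<omega>) -` D \<inter> space M | D. D \<in> sets borel} \<and>
        distributed M lborel (\<lambda>\<omega>. W t \<omega> - W s \<omega>)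
          (\<lambda>z. ennreal (mvnormal_density ((t - s) *\<^sub>R Q) z)))"

section \<open>Stock prices\<close>

text \<open>The Ito integral of \<open>X\<close> with respect to the Wiener process \<open>V\<close> over \<open>{0..t}\<close>, as the limit
  in probability of the left-endpoint Riemann sums when the mesh of the partition
  \<open>0 = u 0 \<le> \<dots> \<le> u n = t\<close> tends to zero. This describes the Ito integral for
  adapted integrands with continuous paths, and is used for such integrands only.\<close>

definition has_ito_integral ::
  "'a measure \<Rightarrow> (real \<Rightarrow> 'a \<Rightarrow> real) \<Rightarrow> (real \<Rightarrow> 'a \<Rightarrow> real) \<Rightarrow> real \<Rightarrow> ('a \<Rightarrow> real) \<Rightarrow> bool" where
  "has_ito_integral M X V t I \<longleftrightarrow>
     I \<in> borel_measurable M \<and>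
     (\<forall>\<epsilon>>0. \<exists>\<delta>>0. \<forall>n u. u 0 = 0 \<and> u n = t \<and> (\<forall>k<n. u k \<le> u (Suc k) \<and> u (Suc k) - u k < \<delta>) \<longrightarrow>
        measure M {\<omega> \<in> space M.
          \<epsilon> < \<bar>(\<Sum>k<n. X (u k) \<omega> * (V (u (Suc k)) \<omega> - V (u k) \<omega>)) - I \<omega>\<bar>} < \<epsilon>)"

text \<open>\<open>X\<close> solves \<open>dX = X (a dt + s dV)\<close> on \<open>{0..T}\<close> with \<open>X 0 = x0\<close>.\<close>

definition black_scholes_stock ::
  "'a measure \<Rightarrow> (real \<Rightarrow> 'a measure) \<Rightarrow> real \<Rightarrow> real \<Rightarrow> real \<Rightarrow> real \<Rightarrow>
   (real \<Rightarrow> 'a \<Rightarrow> real) \<Rightarrow> (real \<Rightarrow> 'a \<Rightarrow> real) \<Rightarrow> bool" where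
  "black_scholes_stock M F T a s x0 V X \<longleftrightarrow>
     adapted F T X \<and>
     (AE \<omega> in M. continuous_on {0..T} (\<lambda>t. X t \<omega>)) \<and>
     (AE \<omega> in M. X 0 \<omega> = x0) \<and>
     (\<forall>t\<in>{0..T}. \<exists>I. has_ito_integral M (\<lambda>u \<omega>. X u \<omega> * s) V t I \<and>
        (AE \<omega> in M. X t \<omega> = X 0 \<omega> + integral {0..t} (\<lambda>u. X u \<omega> * a) + I \<omega>))"

section \<open>Densities\<close>

definition pdf :: "'a measure \<Rightarrow> ('a \<Rightarrow> 'b::euclidean_space) \<Rightarrow> 'b \<Rightarrow> real" where
  "pdf M X x = enn2real (RN_deriv lborel (distr M lborel X) x)"

text \<open>\<open>cond_pdf M X Y y\<close> is the density of \<open>X\<close> given \<open>Y = y\<close>.\<close>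

definition cond_pdf :: "'a measure \<Rightarrow> ('a \<Rightarrow> real) \<Rightarrow> ('a \<Rightarrow> real) \<Rightarrow> real \<Rightarrow> real \<Rightarrow> real" where
  "cond_pdf M X Y y x = pdf M (\<lambda>\<omega>. (X \<omega>, Y \<omega>)) (x, y) / pdf M Y y"

section \<open>Risk auxiliary functions\<close>

text \<open>\<open>P\<close> is the real-world measure, \<open>Pt\<close> the martingale measure and \<open>Z\<close> the density of \<open>Pt\<close>
  with respect to \<open>P\<close>.\<close>

definition Psi1_lin :: "'a measure \<Rightarrow> ('a \<Rightarrow> real) \<Rightarrow> ('a \<Rightarrow> real) \<Rightarrow> real \<Rightarrow> real" where
  "Psi1_lin P Z H c = (\<integral>\<omega>. H \<omega> * indicator {\<omega>. inverse (Z \<omega>) \<ge> c} \<omega> \<partial>P)"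

definition Psi2_lin :: "'a measure \<Rightarrow> ('a \<Rightarrow> real) \<Rightarrow> ('a \<Rightarrow> real) \<Rightarrow> real \<Rightarrow> real" where
  "Psi2_lin Pt Z H c = (\<integral>\<omega>. H \<omega> * indicator {\<omega>. inverse (Z \<omega>) \<ge> c} \<omega> \<partial>Pt)"

definition phi_pow :: "real \<Rightarrow> ('a \<Rightarrow> real) \<Rightarrow> ('a \<Rightarrow> real) \<Rightarrow> real \<Rightarrow> 'a \<Rightarrow> real" where
  "phi_pow p Z H c \<omega> =
     (1 - min ((c * Z \<omega>) powr (1 / (p - 1)) / H \<omega>) 1) * indicator {\<omega>. H \<omega> > 0} \<omega>"

definition Psi1_pow :: "'a measure \<Rightarrow> real \<Rightarrow> ('a \<Rightarrow> real) \<Rightarrow> ('a \<Rightarrow> real) \<Rightarrow> real \<Rightarrow> real" where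
  "Psi1_pow P p Z H c = 1 / p * (\<integral>\<omega>. ((1 - phi_pow p Z H c \<omega>) * H \<omega>) powr p \<partial>P)"

definition Psi2_pow :: "'a measure \<Rightarrow> real \<Rightarrow> ('a \<Rightarrow> real) \<Rightarrow> ('a \<Rightarrow> real) \<Rightarrow> real \<Rightarrow> real" where
  "Psi2_pow Pt p Z H c = (\<integral>\<omega>. H \<omega> * phi_pow p Z H c \<omega> \<partial>Pt)"

text \<open>The library has \<open>ln 0 = 0\<close>; here \<open>ln 0 = -\<infinity>\<close>.\<close>

definition ln_ext :: "real \<Rightarrow> ereal" where
  "ln_ext c = (if c = 0 then -\<infinity> else ereal (ln c))"

end

theory Submission
  imports Defs "HOL-Real_Asymp.Real_Asymp"
begin

text \<open>The stock equation only says that, at each fixed time, the price is the limit in probability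
  of left-endpoint sums, so the first point is that it forces \<open>S\<close> to be a geometric Wiener process
  \<open>G\<close>. An explicit second moment computation shows that \<open>G\<close> satisfies the same approximate Euler
  recursion, hence so does \<open>D = S - G\<close>, with \<open>D 0 = 0\<close>. Truncating \<open>D\<close> at a level \<open>R\<close> gives a bounded
  adapted process \<open>z\<close> whose second moment satisfies \<open>E (z t)\<^sup>2 \<le> C * integral {0..t} (\<lambda>u. E (z u)\<^sup>2)\<close>
  (as a bound by Riemann sums), and iterating this gives \<open>R\<^sup>2 (C t)\<^sup>k / k!\<close> for every \<open>k\<close>, so \<open>z = 0\<close>.

  Afterwards every risk function is the integral of a function of the two terminal values, and
  the formulas disintegrate it along the second one. Under either measure the pair of noises has an
  absolutely continuous law and finite exponential moments, and in terms of the shifted noises the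
  stocks under the martingale measure have the same form with drift \<open>r\<close>; so both are instances of
  one computation.\<close>

section \<open>Increments of a scalar Wiener process\<close>

text \<open>Two obstacles shape the uniqueness argument. The price is only adapted and continuous,
  so it has no moments to start from, and convergence in probability says nothing about
  expectations. Boundedness by \<open>R\<close> removes both at once: an event of small probability
  then costs at most R^2 times that probability. The truncated \<open>z\<close> still obeys the
  Euler recursion wherever it matters: if \<open>z t\<close> is nonzero along a continuous path,
  nothing was cut before \<open>t\<close>, so all earlier grid values of \<open>z\<close> agree with
  \<open>D\<close> there.

  The factor in the iterated bound is \<open>4 * (2 * a\<^sup>2 * T + s\<^sup>2)\<close>. One factor
  2 separates drift from noise in an Euler sum, the other separates the Euler sum from the residual.
  The factorial comes from comparing a sum of k-th powers with the integral of x^k.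

  The second half rests on two facts that survive the change of measure: null sets stay null under a
  density, and multiplying an exponential of the noises by \<open>Z\<close> gives, up to a constant,
  another such exponential.\<close>

lemma normal_density_times_exp:
  assumes "0 < \<sigma>"
  shows "normal_density 0 \<sigma> x * exp (l * x) = exp (l\<^sup>2 * \<sigma>\<^sup>2 / 2) * normal_density (l * \<sigma>\<^sup>2) \<sigma> x"
proof -
  have "- (x\<^sup>2 / (2 * \<sigma>\<^sup>2)) + l * x = l\<^sup>2 * \<sigma>\<^sup>2 / 2 - (x - l * \<sigma>\<^sup>2)\<^sup>2 / (2 * \<sigma>\<^sup>2)"
    using assms by (simp add: field_simps power2_eq_square)
  then show ?thesis
    by (simp add: normal_density_def exp_add[symmetric] mult.assoc mult.left_commute)
qed

lemma square_integrable_mult: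
  fixes f g :: "'a \<Rightarrow> real"
  assumes "integrable M (\<lambda>x. (f x)\<^sup>2)" "integrable M (\<lambda>x. (g x)\<^sup>2)"
    and [measurable]: "f \<in> borel_measurable M" "g \<in> borel_measurable M"
  shows "integrable M (\<lambda>x. f x * g x)"
proof (rule Bochner_Integration.integrable_bound[where f = "\<lambda>x. (f x)\<^sup>2 + (g x)\<^sup>2"])
  show "AE x in M. norm (f x * g x) \<le> norm ((f x)\<^sup>2 + (g x)\<^sup>2)"
  proof (rule AE_I2)
    fix x
    have "2 * (\<bar>f x\<bar> * \<bar>g x\<bar>) \<le> (f x)\<^sup>2 + (g x)\<^sup>2"
      using sum_squares_bound[of "\<bar>f x\<bar>" "\<bar>g x\<bar>"] by (simp add: mult.assoc)
    moreover have "0 \<le> \<bar>f x\<bar> * \<bar>g x\<bar>" by simp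
    ultimately have "\<bar>f x\<bar> * \<bar>g x\<bar> \<le> (f x)\<^sup>2 + (g x)\<^sup>2" by linarith
    then show "norm (f x * g x) \<le> norm ((f x)\<^sup>2 + (g x)\<^sup>2)"
      by (simp add: abs_mult)
  qed
qed (use assms in auto)

text \<open>A stock is driven by one coordinate of the planar process but is adapted to a filtration
  that carries both. Hence the increments are assumed independent of the whole of
  \<open>F s\<close>, not merely of the past of \<open>V\<close>.\<close>

locale scalar_wiener = prob_space M for M :: "'a measure" +
  fixes F :: "real \<Rightarrow> 'a measure" and T :: real and V :: "real \<Rightarrow> 'a \<Rightarrow> real"
  assumes sub_filtration: "sub_filtration M F"
    and adapted: "adapted F T V"
    and start: "AE \<omega> in M. V 0 \<omega> = 0"
    and paths: "AE \<omega> in M. continuous_on {0..T} (\<lambda>t. V t \<omega>)"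
    and indep: "\<And>s t. 0 \<le> s \<Longrightarrow> s < t \<Longrightarrow> t \<le> T \<Longrightarrow>
      indep_set (sets (F s)) {(\<lambda>\<omega>. V t \<omega> - V s \<omega>) -` D \<inter> space M | D. D \<in> sets borel}"
    and incr: "\<And>s t. 0 \<le> s \<Longrightarrow> s < t \<Longrightarrow> t \<le> T \<Longrightarrow>
      distributed M lborel (\<lambda>\<omega>. V t \<omega> - V s \<omega>) (\<lambda>x. ennreal (normal_density 0 (sqrt (t - s)) x))"
begin

lemma space_F: "space (F s) = space M"
  using sub_filtration unfolding sub_filtration_def filtration_def by blast

lemma sets_F_mono: "s \<le> t \<Longrightarrow> sets (F s) \<subseteq> sets (F t)"
  using sub_filtration unfolding sub_filtration_def filtration_def by blast

lemma sets_F_le: "sets (F s) \<subseteq> sets M"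
  using sub_filtration unfolding sub_filtration_def by blast

lemma F_mono: "s \<le> t \<Longrightarrow> f \<in> borel_measurable (F s) \<Longrightarrow> f \<in> borel_measurable (F t)"
  using sets_F_mono[of s t] by (auto simp: measurable_def space_F)

lemma F_le: "f \<in> borel_measurable (F s) \<Longrightarrow> f \<in> borel_measurable M"
  using sets_F_le[of s] by (auto simp: measurable_def space_F)

lemma V_F: "0 \<le> t \<Longrightarrow> t \<le> T \<Longrightarrow> V t \<in> borel_measurable (F t)"
  using adapted unfolding adapted_def by auto

lemma V_M: "0 \<le> t \<Longrightarrow> t \<le> T \<Longrightarrow> V t \<in> borel_measurable M"
  using V_F F_le by blast

lemma indep_incr:
  fixes f g :: "_ \<Rightarrow> real"
  assumes "0 \<le> s" "s < t" "t \<le> T" "f \<in> borel_measurable (F s)" "g \<in> borel_measurable borel"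
  shows "indep_var borel f borel (\<lambda>\<omega>. g (V t \<omega> - V s \<omega>))"
proof -
  have [measurable]: "f \<in> borel_measurable M" "V t \<in> borel_measurable M" "V s \<in> borel_measurable M"
    using assms by (auto intro: F_le V_M)
  note [measurable] = assms(5)
  have 1: "{f -` A \<inter> space M | A. A \<in> sets borel} \<subseteq> sets (F s)"
    using assms(4) space_F by (auto simp: measurable_def)
  have 2: "{(\<lambda>\<omega>. g (V t \<omega> - V s \<omega>)) -` A \<inter> space M | A. A \<in> sets borel}
     \<subseteq> {(\<lambda>\<omega>. V t \<omega> - V s \<omega>) -` D \<inter> space M | D. D \<in> sets borel}"
  proof safe
    fix A :: "real set" assume "A \<in> sets borel"
    then have "g -` A \<in> sets borel"
      using measurable_sets[OF assms(5), of A] by simp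
    then show "\<exists>D. (\<lambda>\<omega>. g (V t \<omega> - V s \<omega>)) -` A \<inter> space M
        = (\<lambda>\<omega>. V t \<omega> - V s \<omega>) -` D \<inter> space M \<and> D \<in> sets borel"
      by (intro exI[of _ "g -` A"]) auto
  qed
  \<comment> \<open>Preimages of the Borel sets under one function already form a sigma-algebra, so
    the generated sigma-algebras in \<open>indep_var_eq\<close> add nothing.\<close>
  have sig: "sigma_sets (space M) {k -` A \<inter> space M | A. A \<in> sets borel}
      = {k -` A \<inter> space M | A. A \<in> sets borel}" for k :: "'a \<Rightarrow> real"
    using sets_vimage_algebra[of "space M" k borel] sets_vimage_algebra2[of k "space M" borel] by simp
  have mono: "indep_set C D" if "indep_set A B" "C \<subseteq> A" "D \<subseteq> B" for A B C D
    using that unfolding indep_sets2_eq by (meson subset_iff)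
  show ?thesis
    unfolding indep_var_eq sig
    using mono[OF indep[OF assms(1-3)] 1 2] by simp
qed

lemma incr_mult:
  fixes f g :: "_ \<Rightarrow> real"
  assumes "0 \<le> s" "s < t" "t \<le> T" "f \<in> borel_measurable (F s)" "g \<in> borel_measurable borel"
    and "integrable M f" "integrable M (\<lambda>\<omega>. g (V t \<omega> - V s \<omega>))"
  shows "integrable M (\<lambda>\<omega>. f \<omega> * g (V t \<omega> - V s \<omega>))"
    and "expectation (\<lambda>\<omega>. f \<omega> * g (V t \<omega> - V s \<omega>)) = expectation f * expectation (\<lambda>\<omega>. g (V t \<omega> - V s \<omega>))"
  using indep_var_integrable[OF indep_incr[OF assms(1-5)] assms(6,7)]
    indep_var_lebesgue_integral[OF indep_incr[OF assms(1-5)] assms(6,7)]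
  by auto

text \<open>A replacement for the Ito isometry that tolerates a drift. Splitting \<psi> into its
  mean \<open>m\<close> and a centred part makes the centred terms orthogonal, since each increment
  is independent of everything before it. The constant part is handled by Cauchy-Schwarz, which
  costs the factor n. This is harmless in both uses, the one-step error of the geometric process and
  a plain Euler step, because \<open>m\<close> is there at most of the order of the mesh.\<close>

lemma sum_incr_L2:
  fixes \<psi> :: "real \<Rightarrow> real" and h :: "nat \<Rightarrow> 'a \<Rightarrow> real"
  assumes u: "\<And>j. j < n \<Longrightarrow> 0 \<le> u j \<and> u j < u (Suc j) \<and> u (Suc j) \<le> T"
    and h: "\<And>j. j < n \<Longrightarrow> h j \<in> borel_measurable (F (u j))"
    and h2: "\<And>j. j < n \<Longrightarrow> integrable M (\<lambda>\<omega>. (h j \<omega>)\<^sup>2)"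
    and psi[measurable]: "\<psi> \<in> borel_measurable borel"
    and psi2: "\<And>j. j < n \<Longrightarrow> integrable M (\<lambda>\<omega>. (\<psi> (V (u (Suc j)) \<omega> - V (u j) \<omega>))\<^sup>2)"
    and m: "\<And>j. j < n \<Longrightarrow> expectation (\<lambda>\<omega>. \<psi> (V (u (Suc j)) \<omega> - V (u j) \<omega>)) = m"
    and v: "\<And>j. j < n \<Longrightarrow> expectation (\<lambda>\<omega>. (\<psi> (V (u (Suc j)) \<omega> - V (u j) \<omega>))\<^sup>2) = v"
  shows "integrable M (\<lambda>\<omega>. (\<Sum>j<n. h j \<omega> * \<psi> (V (u (Suc j)) \<omega> - V (u j) \<omega>))\<^sup>2)" (is ?int)
    and "expectation (\<lambda>\<omega>. (\<Sum>j<n. h j \<omega> * \<psi> (V (u (Suc j)) \<omega> - V (u j) \<omega>))\<^sup>2)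
      \<le> 2 * (real n * m\<^sup>2 + v) * (\<Sum>j<n. expectation (\<lambda>\<omega>. (h j \<omega>)\<^sup>2))" (is ?bound)
proof -
  define d where "d j \<omega> = V (u (Suc j)) \<omega> - V (u j) \<omega>" for j \<omega>
  have dM: "d j \<in> borel_measurable M" if "j < n" for j
    unfolding d_def[abs_def] using u[OF that]
    by (intro borel_measurable_diff V_M) auto
  have hM: "h j \<in> borel_measurable M" if "j < n" for j
    using h[OF that] by (rule F_le)
  have psi1: "integrable M (\<lambda>\<omega>. \<psi> (d j \<omega>))" if "j < n" for j
  proof -
    have "(\<lambda>\<omega>. \<psi> (d j \<omega>)) \<in> borel_measurable M"
      using dM[OF that] psi by (rule measurable_compose)
    moreover have "integrable M (\<lambda>\<omega>. (\<psi> (d j \<omega>))\<^sup>2)"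
      using psi2[OF that] by (simp add: d_def)
    ultimately show ?thesis by (rule square_integrable_imp_integrable)
  qed
  define \<phi> where "\<phi> x = \<psi> x - m" for x
  have phi_meas[measurable]: "\<phi> \<in> borel_measurable borel"
    unfolding \<phi>_def[abs_def] by simp
  have phi2: "integrable M (\<lambda>\<omega>. (\<phi> (d j \<omega>))\<^sup>2)" if "j < n" for j
    unfolding \<phi>_def power2_diff using psi2[OF that] psi1[OF that] by (simp add: d_def)
  have phi1: "integrable M (\<lambda>\<omega>. \<phi> (d j \<omega>))" if "j < n" for j
    unfolding \<phi>_def using psi1[OF that] by simp
  have phim: "expectation (\<lambda>\<omega>. \<phi> (d j \<omega>)) = 0" if "j < n" for j
    unfolding \<phi>_def using psi1[OF that] m[OF that] by (simp add: d_def prob_space)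
  have phiv: "expectation (\<lambda>\<omega>. (\<phi> (d j \<omega>))\<^sup>2) = v - m\<^sup>2" if "j < n" for j
    unfolding \<phi>_def power2_diff using psi1[OF that] psi2[OF that] m[OF that] v[OF that]
    by (simp add: d_def prob_space power2_eq_square)
  define S where "S k \<omega> = (\<Sum>j<k. h j \<omega> * \<phi> (d j \<omega>))" for k \<omega>
  have SM: "S k \<in> borel_measurable M" if "k \<le> n" for k
    unfolding S_def[abs_def] using that
    by (intro borel_measurable_sum borel_measurable_times measurable_compose[OF dM phi_meas] hM) auto
  have SF: "S k \<in> borel_measurable (F (u k))" if "k < n" for k
  proof -
    have le: "u i \<le> u j" if "i \<le> j" "j \<le> n" for i j
      using that
    proof (induction j)
      case (Suc j)
      then show ?case using u[of j] by (cases "i = Suc j") auto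
    qed simp
    show ?thesis
      unfolding S_def[abs_def]
    proof (intro borel_measurable_sum borel_measurable_times)
      fix j assume "j \<in> {..<k}"
      then have j: "j < k" by simp
      show "h j \<in> borel_measurable (F (u k))"
        using h[of j] le[of j k] j that by (intro F_mono[of "u j" "u k"]) auto
      have "V (u (Suc j)) \<in> borel_measurable (F (u k))"
        using le[of "Suc j" k] j that u[of j] by (intro F_mono[of "u (Suc j)" "u k"] V_F) auto
      moreover have "V (u j) \<in> borel_measurable (F (u k))"
        using le[of j k] j that u[of j] by (intro F_mono[of "u j" "u k"] V_F) auto
      ultimately have "d j \<in> borel_measurable (F (u k))"
        unfolding d_def[abs_def] by simp
      then show "(\<lambda>\<omega>. \<phi> (d j \<omega>)) \<in> borel_measurable (F (u k))"
        using phi_meas by (rule measurable_compose)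
    qed
  qed
  have S: "integrable M (\<lambda>\<omega>. (S k \<omega>)\<^sup>2) \<and>
      expectation (\<lambda>\<omega>. (S k \<omega>)\<^sup>2) = (v - m\<^sup>2) * (\<Sum>j<k. expectation (\<lambda>\<omega>. (h j \<omega>)\<^sup>2))" if "k \<le> n" for k
    using that
  proof (induction k)
    case 0
    then show ?case by (simp add: S_def)
  next
    case (Suc k)
    then have k: "k < n" by simp
    note uk = u[OF k]
    have hk: "integrable M (\<lambda>\<omega>. (h k \<omega>)\<^sup>2 * (\<phi> (d k \<omega>))\<^sup>2)"
      "expectation (\<lambda>\<omega>. (h k \<omega>)\<^sup>2 * (\<phi> (d k \<omega>))\<^sup>2) = expectation (\<lambda>\<omega>. (h k \<omega>)\<^sup>2) * (v - m\<^sup>2)"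
      using incr_mult[of "u k" "u (Suc k)" "\<lambda>\<omega>. (h k \<omega>)\<^sup>2" "\<lambda>x. (\<phi> x)\<^sup>2"] uk h[OF k] h2[OF k] phi2[OF k] phiv[OF k]
      by (simp_all add: d_def)
    \<comment> \<open>The cross term: \<open>S k\<close> and \<open>h k\<close> are known at time
      \<open>u k\<close>, so their product is independent of the centred \<phi> of the next
      increment and the expectation is 0.\<close>
    have "integrable M (\<lambda>\<omega>. S k \<omega> * h k \<omega>)"
      using Suc k by (intro square_integrable_mult h2 SM hM) auto
    then have c: "integrable M (\<lambda>\<omega>. S k \<omega> * h k \<omega> * \<phi> (d k \<omega>))"
      "expectation (\<lambda>\<omega>. S k \<omega> * h k \<omega> * \<phi> (d k \<omega>)) = 0"
      using incr_mult[of "u k" "u (Suc k)" "\<lambda>\<omega>. S k \<omega> * h k \<omega>" "\<phi>"] uk SF[OF k] h[OF k] phi1[OF k] phim[OF k]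
      by (simp_all add: d_def)
    have "(S (Suc k) \<omega>)\<^sup>2 = (S k \<omega>)\<^sup>2 + (h k \<omega>)\<^sup>2 * (\<phi> (d k \<omega>))\<^sup>2 + 2 * (S k \<omega> * h k \<omega> * \<phi> (d k \<omega>))" for \<omega>
      by (simp add: S_def power2_eq_square algebra_simps)
    then show ?case
      using Suc hk c by (simp add: algebra_simps)
  qed
  have Sh: "(\<Sum>j<n. h j \<omega> * \<psi> (d j \<omega>)) = S n \<omega> + m * (\<Sum>j<n. h j \<omega>)" for \<omega>
    by (simp add: S_def \<phi>_def algebra_simps sum.distrib[symmetric] sum_distrib_left)
  have le: "(\<Sum>j<n. h j \<omega> * \<psi> (d j \<omega>))\<^sup>2 \<le> 2 * (S n \<omega>)\<^sup>2 + 2 * m\<^sup>2 * real n * (\<Sum>j<n. (h j \<omega>)\<^sup>2)" for \<omega>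
  proof -
    have "(\<Sum>j<n. h j \<omega>)\<^sup>2 \<le> real n * (\<Sum>j<n. (h j \<omega>)\<^sup>2)"
      using Cauchy_Schwarz_ineq_sum[of "\<lambda>_. 1" "\<lambda>j. h j \<omega>" "{..<n}"] by simp
    then have "m\<^sup>2 * (\<Sum>j<n. h j \<omega>)\<^sup>2 \<le> m\<^sup>2 * (real n * (\<Sum>j<n. (h j \<omega>)\<^sup>2))"
      by (intro mult_left_mono) auto
    moreover have "(S n \<omega> + m * (\<Sum>j<n. h j \<omega>))\<^sup>2 \<le> 2 * (S n \<omega>)\<^sup>2 + 2 * (m * (\<Sum>j<n. h j \<omega>))\<^sup>2"
      using sum_squares_bound[of "S n \<omega>" "m * (\<Sum>j<n. h j \<omega>)"] by (simp add: power2_sum)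
    ultimately show ?thesis
      unfolding Sh by (simp add: power_mult_distrib algebra_simps)
  qed
  have int: "integrable M (\<lambda>\<omega>. 2 * (S n \<omega>)\<^sup>2 + 2 * m\<^sup>2 * real n * (\<Sum>j<n. (h j \<omega>)\<^sup>2))"
    using S[of n] h2 by (auto intro!: Bochner_Integration.integrable_add integrable_mult_right Bochner_Integration.integrable_sum)
  have i: "integrable M (\<lambda>\<omega>. (\<Sum>j<n. h j \<omega> * \<psi> (d j \<omega>))\<^sup>2)"
  proof (rule Bochner_Integration.integrable_bound[OF int])
    show "(\<lambda>\<omega>. (\<Sum>j<n. h j \<omega> * \<psi> (d j \<omega>))\<^sup>2) \<in> borel_measurable M"
      by (intro borel_measurable_power borel_measurable_sum borel_measurable_times
          measurable_compose[OF dM psi] hM) auto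
    show "AE \<omega> in M. norm ((\<Sum>j<n. h j \<omega> * \<psi> (d j \<omega>))\<^sup>2)
        \<le> norm (2 * (S n \<omega>)\<^sup>2 + 2 * m\<^sup>2 * real n * (\<Sum>j<n. (h j \<omega>)\<^sup>2))"
    proof (rule AE_I2)
      fix \<omega>
      have "norm ((\<Sum>j<n. h j \<omega> * \<psi> (d j \<omega>))\<^sup>2) = (\<Sum>j<n. h j \<omega> * \<psi> (d j \<omega>))\<^sup>2" by simp
      also note le[of \<omega>]
      also have "2 * (S n \<omega>)\<^sup>2 + 2 * m\<^sup>2 * real n * (\<Sum>j<n. (h j \<omega>)\<^sup>2)
        \<le> norm (2 * (S n \<omega>)\<^sup>2 + 2 * m\<^sup>2 * real n * (\<Sum>j<n. (h j \<omega>)\<^sup>2))" by simp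
      finally show "norm ((\<Sum>j<n. h j \<omega> * \<psi> (d j \<omega>))\<^sup>2)
        \<le> norm (2 * (S n \<omega>)\<^sup>2 + 2 * m\<^sup>2 * real n * (\<Sum>j<n. (h j \<omega>)\<^sup>2))" .
    qed
  qed
  then show ?int by (simp add: d_def)
  have "expectation (\<lambda>\<omega>. (\<Sum>j<n. h j \<omega> * \<psi> (d j \<omega>))\<^sup>2)
    \<le> expectation (\<lambda>\<omega>. 2 * (S n \<omega>)\<^sup>2 + 2 * m\<^sup>2 * real n * (\<Sum>j<n. (h j \<omega>)\<^sup>2))"
    by (rule integral_mono[OF i int le])
  also have "\<dots> = 2 * expectation (\<lambda>\<omega>. (S n \<omega>)\<^sup>2) + 2 * m\<^sup>2 * real n * (\<Sum>j<n. expectation (\<lambda>\<omega>. (h j \<omega>)\<^sup>2))"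
    using S[of n] h2 by (subst Bochner_Integration.integral_add)
      (auto intro!: integrable_mult_right Bochner_Integration.integrable_sum simp: Bochner_Integration.integral_sum)
  also have "\<dots> = (2 * (v - m\<^sup>2) + 2 * m\<^sup>2 * real n) * (\<Sum>j<n. expectation (\<lambda>\<omega>. (h j \<omega>)\<^sup>2))"
    using S[of n] by (simp add: algebra_simps)
  \<comment> \<open>The variance \<open>v - m\<^sup>2\<close> is replaced by \<open>v\<close>, which
    only drops a negative term.\<close>
  also have "\<dots> \<le> (2 * (real n * m\<^sup>2 + v)) * (\<Sum>j<n. expectation (\<lambda>\<omega>. (h j \<omega>)\<^sup>2))"
    by (intro mult_right_mono sum_nonneg) (auto simp: algebra_simps)
  finally show ?bound by (simp add: d_def)
qed

end

section \<open>Convergence in probability to zero\<close>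

lemma riemann_sums_tendsto:
  fixes f :: "real \<Rightarrow> real"
  assumes f: "continuous_on {0..t} f" and t: "0 < t"
  shows "(\<lambda>n. \<Sum>j<n. f (real j * t / real n) * (t / real n)) \<longlonglongrightarrow> integral {0..t} f"
proof (rule LIMSEQ_I)
  fix e :: real assume e: "0 < e"
  \<comment> \<open>The pieces have total length t, so an error of at most e' per unit of length
    adds up to e / 2, strictly below e.\<close>
  define e' where "e' = e / (2 * t)"
  have e': "0 < e'" using e t by (simp add: e'_def)
  have "uniformly_continuous_on {0..t} f"
    using f by (rule compact_uniformly_continuous) simp
  then obtain \<delta> where \<delta>: "0 < \<delta>"
    and uc: "\<And>x y. x \<in> {0..t} \<Longrightarrow> y \<in> {0..t} \<Longrightarrow> dist y x < \<delta> \<Longrightarrow> dist (f y) (f x) < e'"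
    using e' unfolding uniformly_continuous_on_def by metis
  obtain n0 :: nat where n0: "t / \<delta> < real n0"
    using reals_Archimedean2 by blast
  show "\<exists>no. \<forall>n\<ge>no. norm ((\<Sum>j<n. f (real j * t / real n) * (t / real n)) - integral {0..t} f) < e"
  proof (intro exI[of _ "max 1 n0"] allI impI)
    fix n assume "max 1 n0 \<le> n"
    then have n: "0 < n" "t / real n < \<delta>"
      using n0 \<delta> t by (auto simp: field_simps intro: less_le_trans)
    define u where "u j = real j * t / real n" for j :: nat
    have u_le: "u j \<le> u (Suc j)" "0 \<le> u j" for j
      using t n by (auto simp: u_def divide_right_mono)
    have u_t: "u j \<le> t" if "j \<le> n" for j
      using t n that by (auto simp: u_def field_simps)
    have diff: "u (Suc j) - u j = t / real n" for j
      using n by (simp add: u_def field_simps)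
    have int: "f integrable_on {u i..u j}" if "j \<le> n" for i j
      by (rule integrable_continuous_real, rule continuous_on_subset[OF f]) (use u_le u_t[OF that] in auto)
    have "integral {0..u k} f = (\<Sum>j<k. integral {u j..u (Suc j)} f)" if "k \<le> n" for k
      using that
    proof (induction k)
      case 0
      then show ?case by (simp add: u_def)
    next
      case (Suc k)
      have "integral {0..u k} f + integral {u k..u (Suc k)} f = integral {0..u (Suc k)} f"
        using Suc.prems u_le[of k] int[of "Suc k" 0]
        by (intro Henstock_Kurzweil_Integration.integral_combine) (auto simp: u_def)
      then show ?case using Suc by simp
    qed
    from this[of n] have split: "integral {0..t} f = (\<Sum>j<n. integral {u j..u (Suc j)} f)"
      using n by (simp add: u_def)
    have piece: "\<bar>f (u j) * (t / real n) - integral {u j..u (Suc j)} f\<bar> \<le> e' * (t / real n)" if j: "j < n" for j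
    proof -
      have "integral {u j..u (Suc j)} (\<lambda>x. f (u j) - f x) = f (u j) * (t / real n) - integral {u j..u (Suc j)} f"
        using int[of "Suc j" j] j u_le(1)[of j]
        by (subst Henstock_Kurzweil_Integration.integral_diff) (auto simp: diff mult.commute)
      moreover have "norm (integral {u j..u (Suc j)} (\<lambda>x. f (u j) - f x)) \<le> e' * (u (Suc j) - u j)"
      proof (rule integral_bound)
        show "u j \<le> u (Suc j)" by (rule u_le)
        show "continuous_on {u j..u (Suc j)} (\<lambda>x. f (u j) - f x)"
          by (intro continuous_intros continuous_on_subset[OF f]) (use u_le u_t[of "Suc j"] j in auto)
        fix x assume x: "x \<in> {u j..u (Suc j)}"
        have "dist (u j) x < \<delta>"
          using x diff[of j] n by (auto simp: dist_real_def)
        moreover have "x \<in> {0..t}" "u j \<in> {0..t}"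
          using x u_le(2)[of j] u_t[of j] u_t[of "Suc j"] j by auto
        ultimately show "norm (f (u j) - f x) \<le> e'"
          using uc[of x "u j"] by (auto simp: dist_norm)
      qed
      ultimately show ?thesis by (simp add: diff)
    qed
    have "\<bar>(\<Sum>j<n. f (u j) * (t / real n)) - integral {0..t} f\<bar>
        = \<bar>\<Sum>j<n. f (u j) * (t / real n) - integral {u j..u (Suc j)} f\<bar>"
      unfolding split by (simp add: sum_subtractf)
    also have "\<dots> \<le> (\<Sum>j<n. \<bar>f (u j) * (t / real n) - integral {u j..u (Suc j)} f\<bar>)"
      by (rule sum_abs)
    also have "\<dots> \<le> (\<Sum>j<n. e' * (t / real n))"
      by (intro sum_mono piece) auto
    also have "\<dots> = e / 2" using n t by (simp add: e'_def)
    also have "\<dots> < e" using e by simp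
    finally show "norm ((\<Sum>j<n. f (real j * t / real n) * (t / real n)) - integral {0..t} f) < e"
      by (simp add: u_def)
  qed
qed

text \<open>The sum is a lower Riemann sum for the integral of x^k over [0, n]. The induction step
  is Bernoulli's inequality for (1 + 1/n)^(k+1). In the Gronwall iteration this estimate produces
  the factorials.\<close>

lemma sum_power_le: "real (Suc k) * (\<Sum>j<n. real j ^ k) \<le> real n ^ Suc k"
proof (induction n)
  case (Suc n)
  have "real (Suc k) * real n ^ k + real n ^ Suc k \<le> (real n + 1) ^ Suc k"
  proof (cases "n = 0")
    case True
    then show ?thesis by (cases k) auto
  next
    case False
    have "1 + real (Suc k) * (1 / real n) \<le> (1 + 1 / real n) ^ Suc k"
      by (rule Bernoulli_inequality) (simp add: order_trans[of _ 0])
    then have "real n ^ Suc k * (1 + real (Suc k) * (1 / real n)) \<le> real n ^ Suc k * (1 + 1 / real n) ^ Suc k"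
      by (intro mult_left_mono) auto
    also have "\<dots> = (real n + 1) ^ Suc k"
    proof -
      have "real n * (1 + 1 / real n) = real n + 1"
        using False by (simp add: field_simps)
      then show ?thesis by (metis power_mult_distrib)
    qed
    also have "real n ^ Suc k * (1 + real (Suc k) * (1 / real n)) = real (Suc k) * real n ^ k + real n ^ Suc k"
      using False by (simp add: field_simps)
    finally show ?thesis .
  qed
  then show ?case using Suc by (simp add: algebra_simps)
qed simp

definition null_in_prob :: "'a measure \<Rightarrow> (nat \<Rightarrow> 'a \<Rightarrow> real) \<Rightarrow> bool" where
  "null_in_prob M X \<longleftrightarrow> (\<forall>\<epsilon>>0. (\<lambda>n. measure M {\<omega> \<in> space M. \<epsilon> < \<bar>X n \<omega>\<bar>}) \<longlonglongrightarrow> 0)"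

section \<open>Pathwise limits, second moments and limits in probability\<close>

context prob_space begin

lemma null_in_prob_add:
  assumes X: "null_in_prob M X" and Y: "null_in_prob M Y"
    and [measurable]: "\<And>n. X n \<in> borel_measurable M" "\<And>n. Y n \<in> borel_measurable M"
  shows "null_in_prob M (\<lambda>n \<omega>. X n \<omega> + Y n \<omega>)"
  unfolding null_in_prob_def
proof (intro allI impI)
  fix e :: real assume e: "0 < e"
  have "(\<lambda>n. prob {\<omega> \<in> space M. e / 2 < \<bar>X n \<omega>\<bar>} + prob {\<omega> \<in> space M. e / 2 < \<bar>Y n \<omega>\<bar>}) \<longlonglongrightarrow> 0 + 0"
    using X Y half_gt_zero[OF e] unfolding null_in_prob_def by (intro tendsto_add) blast+
  then have lim: "(\<lambda>n. prob {\<omega> \<in> space M. e / 2 < \<bar>X n \<omega>\<bar>} + prob {\<omega> \<in> space M. e / 2 < \<bar>Y n \<omega>\<bar>}) \<longlonglongrightarrow> 0"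
    by simp
  have le: "prob {\<omega> \<in> space M. e < \<bar>X n \<omega> + Y n \<omega>\<bar>}
      \<le> prob {\<omega> \<in> space M. e / 2 < \<bar>X n \<omega>\<bar>} + prob {\<omega> \<in> space M. e / 2 < \<bar>Y n \<omega>\<bar>}" for n
  proof -
    have "prob {\<omega> \<in> space M. e < \<bar>X n \<omega> + Y n \<omega>\<bar>}
      \<le> prob ({\<omega> \<in> space M. e / 2 < \<bar>X n \<omega>\<bar>} \<union> {\<omega> \<in> space M. e / 2 < \<bar>Y n \<omega>\<bar>})"
      by (intro finite_measure_mono) auto
    also have "\<dots> \<le> prob {\<omega> \<in> space M. e / 2 < \<bar>X n \<omega>\<bar>} + prob {\<omega> \<in> space M. e / 2 < \<bar>Y n \<omega>\<bar>}"
      by (intro measure_Un_le) auto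
    finally show ?thesis .
  qed
  show "(\<lambda>n. prob {\<omega> \<in> space M. e < \<bar>X n \<omega> + Y n \<omega>\<bar>}) \<longlonglongrightarrow> 0"
    by (rule tendsto_sandwich[OF _ _ tendsto_const lim]) (simp_all only: le always_eventually measure_nonneg simp_thms)
qed

lemma AE_tendsto_null_in_prob:
  assumes X: "AE \<omega> in M. (\<lambda>n. X n \<omega>) \<longlonglongrightarrow> 0"
    and [measurable]: "\<And>n. X n \<in> borel_measurable M"
  shows "null_in_prob M X"
  unfolding null_in_prob_def
proof (intro allI impI)
  fix e :: real assume e: "0 < e"
  have "(\<lambda>n. expectation (indicator {\<omega> \<in> space M. e < \<bar>X n \<omega>\<bar>} :: 'a \<Rightarrow> real)) \<longlonglongrightarrow> expectation (\<lambda>_. 0)"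
  proof (rule integral_dominated_convergence[where w = "\<lambda>_. 1"])
    show "AE \<omega> in M. (\<lambda>n. indicator {\<omega> \<in> space M. e < \<bar>X n \<omega>\<bar>} \<omega> :: real) \<longlonglongrightarrow> 0"
      using X
    proof eventually_elim
      case (elim \<omega>)
      then have "\<forall>\<^sub>F n in sequentially. \<bar>X n \<omega>\<bar> < e"
        using e by (auto simp: tendsto_iff dist_real_def)
      then have "\<forall>\<^sub>F n in sequentially. indicator {\<omega> \<in> space M. e < \<bar>X n \<omega>\<bar>} \<omega> = (0::real)"
        by eventually_elim auto
      then show ?case by (rule tendsto_eventually)
    qed
  qed (auto split: split_indicator)
  then show "(\<lambda>n. prob {\<omega> \<in> space M. e < \<bar>X n \<omega>\<bar>}) \<longlonglongrightarrow> 0"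
    by simp
qed

text \<open>Chebyshev's inequality. The moment bounds are asked for \<open>0 < n\<close> only,
  because they come from grids with n steps.\<close>

lemma L2_null_in_prob:
  assumes X: "\<And>n. 0 < n \<Longrightarrow> integrable M (\<lambda>\<omega>. (X n \<omega>)\<^sup>2)"
    "\<And>n. 0 < n \<Longrightarrow> expectation (\<lambda>\<omega>. (X n \<omega>)\<^sup>2) \<le> c n" and c: "c \<longlonglongrightarrow> 0"
    and [measurable]: "\<And>n. X n \<in> borel_measurable M"
  shows "null_in_prob M X"
  unfolding null_in_prob_def
proof (intro allI impI)
  fix e :: real assume e: "0 < e"
  have lim: "(\<lambda>n. c n / e\<^sup>2) \<longlonglongrightarrow> 0"
    using tendsto_divide[OF c tendsto_const[of "e\<^sup>2"]] e by simp
  have le: "prob {\<omega> \<in> space M. e < \<bar>X n \<omega>\<bar>} \<le> c n / e\<^sup>2" if n: "0 < n" for n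
  proof -
    have "e < \<bar>x\<bar> \<Longrightarrow> e\<^sup>2 \<le> x\<^sup>2" for x :: real
      using e by (metis abs_le_square_iff abs_of_pos less_imp_le)
    then have "prob {\<omega> \<in> space M. e < \<bar>X n \<omega>\<bar>} \<le> prob {\<omega> \<in> space M. e\<^sup>2 \<le> (X n \<omega>)\<^sup>2}"
      by (intro finite_measure_mono) auto
    also have "\<dots> \<le> expectation (\<lambda>\<omega>. (X n \<omega>)\<^sup>2) / e\<^sup>2"
      using integral_Markov_inequality_measure[OF X(1)[OF n], of "{}" "e\<^sup>2"] e by simp
    also have "\<dots> \<le> c n / e\<^sup>2"
      using X(2)[OF n] by (simp add: divide_right_mono)
    finally show ?thesis .
  qed
  show "(\<lambda>n. prob {\<omega> \<in> space M. e < \<bar>X n \<omega>\<bar>}) \<longlonglongrightarrow> 0"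
    by (rule tendsto_sandwich[OF _ _ tendsto_const lim])
      (auto intro!: always_eventually le eventually_mono[OF eventually_gt_at_top[of 0]])
qed

text \<open>The bridge from a limit in probability to a second moment. Outside the event that the
  residual \<open>X n\<close> exceeds a small threshold, the residual costs little; on that event
  \<open>z\<close> is still bounded by \<open>R\<close>, and the probability tends to 0. Where
  \<open>z\<close> vanishes no equation is demanded, which is exactly what truncation can
  offer.\<close>

lemma L2_le_of_null_in_prob:
  fixes z :: "'a \<Rightarrow> real"
  assumes z: "\<And>\<omega>. \<bar>z \<omega>\<bar> \<le> R" and [measurable]: "z \<in> borel_measurable M"
    and L: "\<And>n. 0 < n \<Longrightarrow> integrable M (\<lambda>\<omega>. (L n \<omega>)\<^sup>2)"
    "\<And>n. 0 < n \<Longrightarrow> expectation (\<lambda>\<omega>. (L n \<omega>)\<^sup>2) \<le> c"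
    and X: "null_in_prob M X" and [measurable]: "\<And>n. X n \<in> borel_measurable M"
    and eq: "AE \<omega> in M. \<forall>n>0. z \<omega> \<noteq> 0 \<longrightarrow> z \<omega> = L n \<omega> + X n \<omega>"
  shows "expectation (\<lambda>\<omega>. (z \<omega>)\<^sup>2) \<le> 2 * c"
proof -
  have R: "(z \<omega>)\<^sup>2 \<le> R\<^sup>2" for \<omega>
    using z[of \<omega>] by (metis abs_ge_zero abs_le_square_iff abs_of_nonneg order_trans)
  have zi: "integrable M (\<lambda>\<omega>. (z \<omega>)\<^sup>2)"
    by (rule integrable_const_bound[where B = "R\<^sup>2"]) (use R in auto)
  have "expectation (\<lambda>\<omega>. (z \<omega>)\<^sup>2) \<le> 2 * c + 2 * e" if e: "0 < e" for e
  proof -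
    \<comment> \<open>Chosen so that a residual of size at most \<open>s\<close> contributes at most
      \<open>e\<close> to the square.\<close>
    define s where "s = sqrt e"
    have s: "0 < s" "s\<^sup>2 = e" using e by (auto simp: s_def)
    define A where "A n = {\<omega> \<in> space M. s < \<bar>X n \<omega>\<bar>}" for n
    have [measurable]: "A n \<in> sets M" for n unfolding A_def by measurable
    have ind: "integrable M (indicator (A n) :: 'a \<Rightarrow> real)" for n
      by (intro integrable_real_indicator) (auto simp: less_top[symmetric])
    have le: "expectation (\<lambda>\<omega>. (z \<omega>)\<^sup>2) \<le> 2 * c + 2 * e + R\<^sup>2 * prob (A n)" if n: "0 < n" for n
    proof -
      have "expectation (\<lambda>\<omega>. (z \<omega>)\<^sup>2) \<le> expectation (\<lambda>\<omega>. 2 * (L n \<omega>)\<^sup>2 + 2 * e + R\<^sup>2 * indicator (A n) \<omega>)"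
      proof (rule integral_mono_AE[OF zi])
        show "integrable M (\<lambda>\<omega>. 2 * (L n \<omega>)\<^sup>2 + 2 * e + R\<^sup>2 * indicator (A n) \<omega>)"
          using L(1)[OF n]
          by (intro Bochner_Integration.integrable_add integrable_mult_right ind) auto
        show "AE \<omega> in M. (z \<omega>)\<^sup>2 \<le> 2 * (L n \<omega>)\<^sup>2 + 2 * e + R\<^sup>2 * indicator (A n) \<omega>"
          using eq AE_space
        proof eventually_elim
          case (elim \<omega>)
          show ?case
          proof (cases "z \<omega> = 0 \<or> \<omega> \<in> A n")
            case True
            then show ?thesis using R[of \<omega>] e by (auto simp: add_increasing)
          next
            case False
            then have "z \<omega> = L n \<omega> + X n \<omega>" "\<bar>X n \<omega>\<bar> \<le> s"
              using elim n by (auto simp: A_def)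
            moreover from this(2) have "(X n \<omega>)\<^sup>2 \<le> e"
              using s by (metis abs_le_square_iff abs_of_pos)
            moreover have "(L n \<omega> + X n \<omega>)\<^sup>2 \<le> 2 * (L n \<omega>)\<^sup>2 + 2 * (X n \<omega>)\<^sup>2"
              using sum_squares_bound[of "L n \<omega>" "X n \<omega>"] by (simp add: power2_sum)
            ultimately show ?thesis using False by simp
          qed
        qed
      qed
      also have "\<dots> = 2 * expectation (\<lambda>\<omega>. (L n \<omega>)\<^sup>2) + 2 * e + R\<^sup>2 * prob (A n)"
      proof -
        have "A n \<inter> space M = A n" by (auto simp: A_def)
        then show ?thesis using L(1)[OF n] ind[of n] by (simp add: prob_space)
      qed
      also have "\<dots> \<le> 2 * c + 2 * e + R\<^sup>2 * prob (A n)"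
        using L(2)[OF n] by simp
      finally show ?thesis .
    qed
    have "(\<lambda>n. 2 * c + 2 * e + R\<^sup>2 * prob (A n)) \<longlonglongrightarrow> 2 * c + 2 * e + R\<^sup>2 * 0"
      using X s unfolding null_in_prob_def A_def by (intro tendsto_intros) auto
    then show ?thesis
      by (intro tendsto_lowerbound[of _ _ sequentially])
        (auto intro!: le eventually_mono[OF eventually_gt_at_top[of 0]])
  qed
  then have "expectation (\<lambda>\<omega>. (z \<omega>)\<^sup>2) \<le> 2 * c + e" if "0 < e" for e
    using that[THEN half_gt_zero] by fastforce
  then show ?thesis by (rule field_le_epsilon)
qed

end

section \<open>Geometric Wiener processes\<close>

text \<open>\<open>defect_mean\<close> and \<open>defect_square\<close> are the first and second
  moments of the error that one Euler step of length h makes on the geometric process,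
  \<open>exp ((a - s\<^sup>2 / 2) * h + s * x) - (1 + a * h + s * x)\<close> with x centred normal
  of variance h. Both are of order h^2 as h tends to 0.\<close>

definition defect_mean :: "real \<Rightarrow> real \<Rightarrow> real" where
  "defect_mean a h = exp (a * h) - 1 - a * h"

definition defect_square :: "real \<Rightarrow> real \<Rightarrow> real \<Rightarrow> real" where
  "defect_square a s h = exp ((2 * a + s\<^sup>2) * h) - 2 * (1 + (a + s\<^sup>2) * h) * exp (a * h) + (1 + a * h)\<^sup>2 + s\<^sup>2 * h"

text \<open>Up to a constant this is the bound that \<open>sum_incr_L2\<close> gives for n steps
  with coefficients bounded in L2. Mean and second moment of a single error are of order 1/n^2, so
  the two terms are of order 1/n^2 and 1/n.\<close>

lemma defect_tendsto:
  "(\<lambda>n. real n * (real n * (defect_mean a (t / real n))\<^sup>2 + defect_square a s (t / real n))) \<longlonglongrightarrow> 0"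
proof -
  have r: "(\<lambda>n. real n * (exp (c / real n) - 1 - c / real n)) \<longlonglongrightarrow> 0" for c
  proof -
    have "((\<lambda>x::real. x * (exp (c / x) - 1 - c / x)) \<longlongrightarrow> 0) at_top"
      by (cases c "0::real" rule: linorder_cases; real_asymp)
    from filterlim_compose[OF this filterlim_real_sequentially] show ?thesis by simp
  qed
  have i: "(\<lambda>n. c / real n) \<longlonglongrightarrow> 0" for c
    by (rule tendsto_divide_0[OF tendsto_const filterlim_at_top_imp_at_infinity[OF filterlim_real_sequentially]])
  \<comment> \<open>Every exponential is expressed through the remainder
    \<open>exp x - 1 - x\<close>, whose n-fold tends to 0 by \<open>r\<close>; what is left over is
    a polynomial term of order 1/n.\<close>
  define m where "m n = real n * (exp (a * t / real n) - 1 - a * t / real n)" for n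
  define q where "q n = real n * (exp ((2 * a + s\<^sup>2) * t / real n) - 1 - (2 * a + s\<^sup>2) * t / real n)" for n
  have "(\<lambda>n. (m n)\<^sup>2 + q n - 2 * (1 + (a + s\<^sup>2) * t / real n) * m n
      + (a\<^sup>2 - 2 * (a + s\<^sup>2) * a) * t * (t / real n)) \<longlonglongrightarrow> 0\<^sup>2 + 0 - 2 * (1 + 0) * 0 + (a\<^sup>2 - 2 * (a + s\<^sup>2) * a) * t * 0"
    unfolding m_def q_def by (intro tendsto_intros r i)
  moreover have "(m n)\<^sup>2 + q n - 2 * (1 + (a + s\<^sup>2) * t / real n) * m n + (a\<^sup>2 - 2 * (a + s\<^sup>2) * a) * t * (t / real n)
      = real n * (real n * (defect_mean a (t / real n))\<^sup>2 + defect_square a s (t / real n))" for n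
  proof (cases "n = 0")
    case False
    define h where "h = t / real n"
    have t: "t = real n * h" using False by (simp add: h_def)
    have c: "c * t / real n = c * h" for c by (simp add: h_def)
    show ?thesis
      unfolding m_def q_def defect_mean_def defect_square_def c h_def[symmetric]
      unfolding t using False by (simp add: power2_eq_square algebra_simps)
  qed (simp add: m_def q_def)
  ultimately show ?thesis by simp
qed

section \<open>Moments of a single step and the Euler scheme of the geometric process\<close>

context scalar_wiener begin

text \<open>Multiplying the centred normal density by \<open>exp (l * x)\<close> shifts its mean to
  \<open>l * (t - s)\<close>, so the exponential moments reduce to the mass and the mean of a
  shifted normal law. The moment of \<open>x * exp (l * x)\<close> is wanted as the cross term in
  the square of the one-step error.\<close>

lemma
  assumes "0 \<le> s" "s < t" "t \<le> T"
  shows integrable_exp_incr: "integrable M (\<lambda>\<omega>. exp (l * (V t \<omega> - V s \<omega>)))"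
    and expectation_exp_incr: "expectation (\<lambda>\<omega>. exp (l * (V t \<omega> - V s \<omega>))) = exp (l\<^sup>2 * (t - s) / 2)"
    and integrable_incr_exp: "integrable M (\<lambda>\<omega>. (V t \<omega> - V s \<omega>) * exp (l * (V t \<omega> - V s \<omega>)))"
    and expectation_incr_exp: "expectation (\<lambda>\<omega>. (V t \<omega> - V s \<omega>) * exp (l * (V t \<omega> - V s \<omega>)))
       = l * (t - s) * exp (l\<^sup>2 * (t - s) / 2)"
    and integrable_incr2: "integrable M (\<lambda>\<omega>. (V t \<omega> - V s \<omega>)\<^sup>2)"
    and expectation_incr2: "expectation (\<lambda>\<omega>. (V t \<omega> - V s \<omega>)\<^sup>2) = t - s"
proof -
  define \<sigma> where "\<sigma> = sqrt (t - s)"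
  have \<sigma>: "0 < \<sigma>" "\<sigma>\<^sup>2 = t - s" using assms by (auto simp: \<sigma>_def)
  note D = incr[OF assms, folded \<sigma>_def]
  note n1 = normal_density_times_exp[OF \<sigma>(1), unfolded \<sigma>(2)]
  have n2: "normal_density 0 \<sigma> x * (x * exp (l * x))
      = exp (l\<^sup>2 * (t - s) / 2) * (normal_density (l * (t - s)) \<sigma> x * x)" for x
    using n1[of x l] by (metis mult.assoc mult.commute)
  show "integrable M (\<lambda>\<omega>. exp (l * (V t \<omega> - V s \<omega>)))"
    using distributed_integrable[OF D, of "\<lambda>x. exp (l * x)"] \<sigma> by (simp add: n1)
  show "expectation (\<lambda>\<omega>. exp (l * (V t \<omega> - V s \<omega>))) = exp (l\<^sup>2 * (t - s) / 2)"
    using distributed_integral[OF D, of "\<lambda>x. exp (l * x)"] \<sigma> by (simp add: n1)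
  show "integrable M (\<lambda>\<omega>. (V t \<omega> - V s \<omega>) * exp (l * (V t \<omega> - V s \<omega>)))"
    using distributed_integrable[OF D, of "\<lambda>x. x * exp (l * x)"] \<sigma>
      integrable_normal_moment_nz_1[OF \<sigma>(1), of "l * (t - s)"] by (simp add: n2)
  have "expectation (\<lambda>\<omega>. (V t \<omega> - V s \<omega>) * exp (l * (V t \<omega> - V s \<omega>)))
       = exp (l\<^sup>2 * (t - s) / 2) * (l * (t - s))"
    using distributed_integral[OF D, of "\<lambda>x. x * exp (l * x)"] \<sigma>
      integral_normal_moment_nz_1[OF \<sigma>(1), of "l * (t - s)"] by (simp add: n2)
  then show "expectation (\<lambda>\<omega>. (V t \<omega> - V s \<omega>) * exp (l * (V t \<omega> - V s \<omega>)))
       = l * (t - s) * exp (l\<^sup>2 * (t - s) / 2)"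
    by (metis mult.commute)
  show "integrable M (\<lambda>\<omega>. (V t \<omega> - V s \<omega>)\<^sup>2)"
    using distributed_integrable[OF D, of "\<lambda>x. x\<^sup>2"] integrable_normal_moment[OF \<sigma>(1), of 0 2] by simp
  show "expectation (\<lambda>\<omega>. (V t \<omega> - V s \<omega>)\<^sup>2) = t - s"
    using normal_distributed_variance[OF \<sigma>(1) D] normal_distributed_expectation[OF \<sigma>(1) D] \<sigma> by simp
qed

lemma
  assumes "0 \<le> s" "s < t" "t \<le> T"
  shows integrable_incr: "integrable M (\<lambda>\<omega>. V t \<omega> - V s \<omega>)"
    and expectation_incr: "expectation (\<lambda>\<omega>. V t \<omega> - V s \<omega>) = 0"
  using integrable_incr_exp[OF assms, of 0] expectation_incr_exp[OF assms, of 0] by simp_all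

lemma
  assumes "0 \<le> u" "u < w" "w \<le> T"
  defines "d \<equiv> \<lambda>\<omega>. V w \<omega> - V u \<omega>"
  shows integrable_euler_incr: "integrable M (\<lambda>\<omega>. (k + s * d \<omega>)\<^sup>2)"
    and expectation_euler_incr: "expectation (\<lambda>\<omega>. k + s * d \<omega>) = k"
    and expectation_euler_incr2: "expectation (\<lambda>\<omega>. (k + s * d \<omega>)\<^sup>2) = k\<^sup>2 + s\<^sup>2 * (w - u)"
proof -
  note i = integrable_incr[OF assms(1-3)] expectation_incr[OF assms(1-3)] integrable_incr2[OF assms(1-3)]
    expectation_incr2[OF assms(1-3)]
  have sq: "(k + s * d \<omega>)\<^sup>2 = k\<^sup>2 + 2 * k * s * d \<omega> + s\<^sup>2 * (d \<omega>)\<^sup>2" for \<omega>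
    by (simp add: power2_eq_square algebra_simps)
  show "integrable M (\<lambda>\<omega>. (k + s * d \<omega>)\<^sup>2)" "expectation (\<lambda>\<omega>. k + s * d \<omega>) = k"
    "expectation (\<lambda>\<omega>. (k + s * d \<omega>)\<^sup>2) = k\<^sup>2 + s\<^sup>2 * (w - u)"
    unfolding sq using i by (simp_all add: d_def prob_space)
qed

lemma
  fixes a s :: real
  assumes "0 \<le> u" "u < w" "w \<le> T"
  defines "h \<equiv> w - u"
  defines "\<eta> \<equiv> \<lambda>x. exp ((a - s\<^sup>2 / 2) * h + s * x) - (1 + a * h + s * x)"
  defines "d \<equiv> \<lambda>\<omega>. V w \<omega> - V u \<omega>"
  shows integrable_defect: "integrable M (\<lambda>\<omega>. (\<eta> (d \<omega>))\<^sup>2)"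
    and expectation_defect: "expectation (\<lambda>\<omega>. \<eta> (d \<omega>)) = defect_mean a h"
    and expectation_defect2: "expectation (\<lambda>\<omega>. (\<eta> (d \<omega>))\<^sup>2) = defect_square a s h"
proof -
  define E where "E = exp ((a - s\<^sup>2 / 2) * h)"
  define q where "q = 1 + a * h"
  have x1: "\<eta> x = E * exp (s * x) - (q + s * x)" for x
    by (simp add: \<eta>_def E_def q_def exp_add)
  have e2: "exp (2 * s * x) = exp (s * x) * exp (s * x)" for x
    by (simp flip: exp_add)
  have x2: "(\<eta> x)\<^sup>2 = E\<^sup>2 * exp (2 * s * x) - 2 * E * q * exp (s * x) - 2 * E * s * (x * exp (s * x))
      + (q\<^sup>2 + 2 * q * s * x + s\<^sup>2 * x\<^sup>2)" for x
    unfolding x1 e2 by (simp add: power2_eq_square algebra_simps)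
  have i: "integrable M d" "expectation d = 0" "integrable M (\<lambda>\<omega>. (d \<omega>)\<^sup>2)" "expectation (\<lambda>\<omega>. (d \<omega>)\<^sup>2) = h"
    "\<And>l. integrable M (\<lambda>\<omega>. exp (l * d \<omega>))" "\<And>l. expectation (\<lambda>\<omega>. exp (l * d \<omega>)) = exp (l\<^sup>2 * h / 2)"
    "\<And>l. integrable M (\<lambda>\<omega>. d \<omega> * exp (l * d \<omega>))" "\<And>l. expectation (\<lambda>\<omega>. d \<omega> * exp (l * d \<omega>)) = l * h * exp (l\<^sup>2 * h / 2)"
    unfolding d_def h_def
    by (rule integrable_incr expectation_incr integrable_incr2 expectation_incr2 integrable_exp_incr
        expectation_exp_incr integrable_incr_exp expectation_incr_exp; fact)+
  \<comment> \<open>The Ito correction \<open>- s\<^sup>2 / 2\<close> cancels the Gaussian factor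
    and leaves \<open>exp (a * h)\<close>; this is why the mean error is of second order in
    h.\<close>
  have E1: "E * exp (s\<^sup>2 * h / 2) = exp (a * h)"
    by (simp add: E_def algebra_simps flip: exp_add)
  have E2: "E\<^sup>2 * exp ((2 * s)\<^sup>2 * h / 2) = exp ((2 * a + s\<^sup>2) * h)"
    by (simp add: E_def power2_eq_square algebra_simps flip: exp_add)
  show "integrable M (\<lambda>\<omega>. (\<eta> (d \<omega>))\<^sup>2)"
    unfolding x2 using i by (intro Bochner_Integration.integrable_add Bochner_Integration.integrable_diff integrable_mult_right) auto
  have "expectation (\<lambda>\<omega>. \<eta> (d \<omega>)) = E * exp (s\<^sup>2 * h / 2) - q"
    unfolding x1 using i by (simp add: prob_space)
  then show "expectation (\<lambda>\<omega>. \<eta> (d \<omega>)) = defect_mean a h"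
    by (simp add: E1 defect_mean_def q_def)
  have "expectation (\<lambda>\<omega>. (\<eta> (d \<omega>))\<^sup>2) = E\<^sup>2 * exp ((2 * s)\<^sup>2 * h / 2) - 2 * E * q * exp (s\<^sup>2 * h / 2)
     - 2 * E * s * (s * h * exp (s\<^sup>2 * h / 2)) + (q\<^sup>2 + s\<^sup>2 * h)"
    unfolding x2 using i by (simp add: prob_space)
  also have "\<dots> = E\<^sup>2 * exp ((2 * s)\<^sup>2 * h / 2) - 2 * (q + s\<^sup>2 * h) * (E * exp (s\<^sup>2 * h / 2)) + q\<^sup>2 + s\<^sup>2 * h"
    by (simp add: power2_eq_square algebra_simps)
  also have "\<dots> = defect_square a s h"
    unfolding E1 E2 by (simp add: defect_square_def q_def algebra_simps)
  finally show "expectation (\<lambda>\<omega>. (\<eta> (d \<omega>))\<^sup>2) = defect_square a s h" .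
qed

definition geom :: "real \<Rightarrow> real \<Rightarrow> real \<Rightarrow> real \<Rightarrow> 'a \<Rightarrow> real" where
  "geom x0 a s t \<omega> = x0 * exp ((a - s\<^sup>2 / 2) * t + s * V t \<omega>)"

lemma geom_F: "0 \<le> t \<Longrightarrow> t \<le> T \<Longrightarrow> geom x0 a s t \<in> borel_measurable (F t)"
  unfolding geom_def[abs_def] using V_F[of t] by simp

lemma
  assumes t: "0 \<le> t" "t \<le> T"
  shows integrable_geom2: "integrable M (\<lambda>\<omega>. (geom x0 a s t \<omega>)\<^sup>2)"
    and expectation_geom2: "expectation (\<lambda>\<omega>. (geom x0 a s t \<omega>)\<^sup>2) = x0\<^sup>2 * exp ((2 * a + s\<^sup>2) * t)"
proof -
  have Vm[measurable]: "V t \<in> borel_measurable M" "V 0 \<in> borel_measurable M"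
    using t V_M by auto
  have gm[measurable]: "geom x0 a s t \<in> borel_measurable M"
    using geom_F[OF t] by (rule F_le)
  define C where "C = x0\<^sup>2 * exp (2 * (a - s\<^sup>2 / 2) * t)"
  \<comment> \<open>Only increments have a known law, so \<open>V t\<close> is replaced by
    \<open>V t - V 0\<close>, which is the same almost surely.\<close>
  have ae: "AE \<omega> in M. (geom x0 a s t \<omega>)\<^sup>2 = C * exp (2 * s * (V t \<omega> - V 0 \<omega>))"
    using start
  proof eventually_elim
    case (elim \<omega>)
    then show ?case
      by (simp add: geom_def C_def power_mult_distrib mult.assoc algebra_simps flip: exp_add exp_double)
  qed
  have int: "integrable M (\<lambda>\<omega>. C * exp (2 * s * (V t \<omega> - V 0 \<omega>)))
      \<and> expectation (\<lambda>\<omega>. C * exp (2 * s * (V t \<omega> - V 0 \<omega>))) = C * exp (2 * s\<^sup>2 * t)"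
  \<comment> \<open>Laws of increments are given for strictly ordered times, so time 0 is treated
    apart.\<close>
  proof (cases "t = 0")
    case True
    then show ?thesis by (simp add: prob_space)
  next
    case False
    then show ?thesis
      using t integrable_exp_incr[of 0 t "2 * s"] expectation_exp_incr[of 0 t "2 * s"]
      by (simp add: power_mult_distrib)
  qed
  then show "integrable M (\<lambda>\<omega>. (geom x0 a s t \<omega>)\<^sup>2)"
    by (subst integrable_cong_AE[OF _ _ ae]) auto
  have "expectation (\<lambda>\<omega>. (geom x0 a s t \<omega>)\<^sup>2) = C * exp (2 * s\<^sup>2 * t)"
    using int by (subst integral_cong_AE[OF _ _ ae]) auto
  then show "expectation (\<lambda>\<omega>. (geom x0 a s t \<omega>)\<^sup>2) = x0\<^sup>2 * exp ((2 * a + s\<^sup>2) * t)"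
    by (simp add: C_def mult.assoc algebra_simps flip: exp_add)
qed

lemma grid:
  fixes t :: real and n j :: nat
  assumes "0 < t" "t \<le> T" "j < n"
  defines "u \<equiv> \<lambda>j. real j * t / real n"
  shows "0 \<le> u j" "u j < u (Suc j)" "u (Suc j) \<le> T" "u j \<le> T" "u j < t" "u (Suc j) - u j = t / real n"
proof -
  show 1: "0 \<le> u j" using assms by (simp add: u_def)
  show 2: "u (Suc j) - u j = t / real n" using assms by (simp add: u_def field_simps)
  moreover have "0 < t / real n" using assms by simp
  ultimately show 3: "u j < u (Suc j)" by linarith
  have "real (Suc j) * t \<le> real n * t"
    using assms by (intro mult_right_mono) auto
  then have "u (Suc j) \<le> t" using assms by (simp add: u_def field_simps)
  with assms 3 show "u (Suc j) \<le> T" "u j \<le> T" "u j < t" by auto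
qed

text \<open>The process is multiplicative: a step multiplies the old value by a function of the next
  increment. Subtracting the Euler step leaves the old value times the one-step error \<eta>, and
  after telescoping the whole defect is a sum of the type treated by
  \<open>sum_incr_L2\<close>.\<close>

lemma geom_euler:
  assumes t: "0 < t" "t \<le> T"
  defines "u \<equiv> \<lambda>n j. real j * t / real n"
  shows "null_in_prob M (\<lambda>n \<omega>. geom x0 a s t \<omega> - geom x0 a s 0 \<omega>
    - (\<Sum>j<n. geom x0 a s (u n j) \<omega> * (a * (t / real n) + s * (V (u n (Suc j)) \<omega> - V (u n j) \<omega>))))"
proof -
  define G where "G = geom x0 a s"
  define E where "E n \<omega> = G t \<omega> - G 0 \<omega>
    - (\<Sum>j<n. G (u n j) \<omega> * (a * (t / real n) + s * (V (u n (Suc j)) \<omega> - V (u n j) \<omega>)))" for n \<omega>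
  define \<eta> where "\<eta> n x = exp ((a - s\<^sup>2 / 2) * (t / real n) + s * x) - (1 + a * (t / real n) + s * x)" for n :: nat and x
  have u_eq: "u n j = real j * t / real n" for n j by (simp add: u_def)
  note u = grid[OF t, folded u_eq]
  have E: "E n \<omega> = (\<Sum>j<n. G (u n j) \<omega> * \<eta> n (V (u n (Suc j)) \<omega> - V (u n j) \<omega>))" if "0 < n" for n \<omega>
  proof -
    have *: "G (u n j) \<omega> * \<eta> n (V (u n (Suc j)) \<omega> - V (u n j) \<omega>)
      = (G (u n (Suc j)) \<omega> - G (u n j) \<omega>) - G (u n j) \<omega> * (a * (t / real n) + s * (V (u n (Suc j)) \<omega> - V (u n j) \<omega>))"
      if "j < n" for j
    proof -
      have "(a - s\<^sup>2 / 2) * u n j + s * V (u n j) \<omega> + ((a - s\<^sup>2 / 2) * (t / real n) + s * (V (u n (Suc j)) \<omega> - V (u n j) \<omega>))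
         = (a - s\<^sup>2 / 2) * u n (Suc j) + s * V (u n (Suc j)) \<omega>"
        unfolding u(6)[OF that, symmetric] by (simp add: field_simps)
      then have "G (u n j) \<omega> * exp ((a - s\<^sup>2 / 2) * (t / real n) + s * (V (u n (Suc j)) \<omega> - V (u n j) \<omega>)) = G (u n (Suc j)) \<omega>"
        by (simp add: G_def geom_def mult.assoc flip: exp_add)
      then show ?thesis by (simp add: \<eta>_def algebra_simps)
    qed
    have "(\<Sum>j<n. G (u n (Suc j)) \<omega> - G (u n j) \<omega>) = G t \<omega> - G 0 \<omega>"
      using that by (subst sum_lessThan_telescope) (simp add: u_def)
    then show ?thesis by (simp add: E_def * sum_subtractf)
  qed
  \<comment> \<open>Bounds the second moment at all times up to \<open>T\<close>; the absolute value
    makes this valid for either sign of the growth rate.\<close>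
  define K where "K = x0\<^sup>2 * exp (\<bar>2 * a + s\<^sup>2\<bar> * T)"
  have GK: "expectation (\<lambda>\<omega>. (G w \<omega>)\<^sup>2) \<le> K" if "0 \<le> w" "w \<le> T" for w
  proof -
    have "(2 * a + s\<^sup>2) * w \<le> \<bar>2 * a + s\<^sup>2\<bar> * T"
      using that by (intro mult_mono) auto
    then show ?thesis
      unfolding G_def K_def expectation_geom2[OF that] by (intro mult_left_mono) auto
  qed
  define c where "c n = 2 * K * (real n * (real n * (defect_mean a (t / real n))\<^sup>2 + defect_square a s (t / real n)))" for n
  have b: "integrable M (\<lambda>\<omega>. (E n \<omega>)\<^sup>2) \<and> expectation (\<lambda>\<omega>. (E n \<omega>)\<^sup>2) \<le> c n" if n: "0 < n" for n
  proof -
    have d: "integrable M (\<lambda>\<omega>. (\<eta> n (V (u n (Suc j)) \<omega> - V (u n j) \<omega>))\<^sup>2)"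
      "expectation (\<lambda>\<omega>. \<eta> n (V (u n (Suc j)) \<omega> - V (u n j) \<omega>)) = defect_mean a (t / real n)"
      "expectation (\<lambda>\<omega>. (\<eta> n (V (u n (Suc j)) \<omega> - V (u n j) \<omega>))\<^sup>2) = defect_square a s (t / real n)" if "j < n" for j
      using integrable_defect[OF u(1-3)[OF that], of a s] expectation_defect[OF u(1-3)[OF that], of a s]
        expectation_defect2[OF u(1-3)[OF that], of a s]
      unfolding u(6)[OF that] \<eta>_def by auto
    \<comment> \<open>The sign of \<open>defect_square\<close> cannot be read off its formula; it is
      nonnegative as a second moment.\<close>
    have nn: "0 \<le> real n * (defect_mean a (t / real n))\<^sup>2 + defect_square a s (t / real n)"
    proof -
      have "0 \<le> defect_square a s (t / real n)"
        unfolding d(3)[OF n, symmetric] by (rule integral_nonneg_AE) simp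
      then show ?thesis by simp
    qed
    note L = sum_incr_L2[where n = n and u = "u n" and h = "\<lambda>j. G (u n j)" and \<psi> = "\<eta> n"
        and m = "defect_mean a (t / real n)" and v = "defect_square a s (t / real n)"]
    have 1: "integrable M (\<lambda>\<omega>. (E n \<omega>)\<^sup>2)"
      unfolding E[OF n] by (rule L(1)) (use u d in \<open>auto simp: G_def \<eta>_def[abs_def] intro!: geom_F integrable_geom2\<close>)
    have "expectation (\<lambda>\<omega>. (E n \<omega>)\<^sup>2) \<le> 2 * (real n * (defect_mean a (t / real n))\<^sup>2 + defect_square a s (t / real n))
        * (\<Sum>j<n. expectation (\<lambda>\<omega>. (G (u n j) \<omega>)\<^sup>2))"
      unfolding E[OF n] by (rule L(2)) (use u d in \<open>auto simp: G_def \<eta>_def[abs_def] intro!: geom_F integrable_geom2\<close>)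
    also have "\<dots> \<le> 2 * (real n * (defect_mean a (t / real n))\<^sup>2 + defect_square a s (t / real n)) * (\<Sum>j<n. K)"
      using nn by (intro mult_left_mono sum_mono GK u) auto
    also have "\<dots> = c n" by (simp add: c_def)
    finally show ?thesis using 1 by simp
  qed
  have lim: "c \<longlonglongrightarrow> 0"
    unfolding c_def[abs_def] using tendsto_mult_left[OF defect_tendsto[of a t s], of "2 * K"] by simp
  have meas: "E n \<in> borel_measurable M" for n
  proof -
    have [measurable]: "G t \<in> borel_measurable M" "G 0 \<in> borel_measurable M"
      using t by (auto simp: G_def intro!: F_le[OF geom_F])
    have "(\<lambda>\<omega>. G (u n j) \<omega> * (a * (t / real n) + s * (V (u n (Suc j)) \<omega> - V (u n j) \<omega>))) \<in> borel_measurable M" if "j < n" for j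
    proof -
      have [measurable]: "G (u n j) \<in> borel_measurable M" "V (u n (Suc j)) \<in> borel_measurable M" "V (u n j) \<in> borel_measurable M"
        using u[OF that] by (auto simp: G_def intro: F_le[OF geom_F] V_M)
      show ?thesis by simp
    qed
    then show ?thesis
      unfolding E_def[abs_def] by (intro borel_measurable_diff borel_measurable_sum) auto
  qed
  have "null_in_prob M E"
    by (rule L2_null_in_prob[OF _ _ lim meas]) (use b in auto)
  then show ?thesis by (simp add: E_def[abs_def] G_def)
qed

end

section \<open>Uniqueness for the stock equation\<close>

context scalar_wiener begin

text \<open>The error of the Euler scheme with n equal steps, accumulated over
  \<open>{0..t}\<close>. It is linear in \<open>X\<close>, so the difference of two processes with
  vanishing residuals has a vanishing residual again.\<close>

definition stock_residual :: "(real \<Rightarrow> 'a \<Rightarrow> real) \<Rightarrow> real \<Rightarrow> real \<Rightarrow> real \<Rightarrow> nat \<Rightarrow> 'a \<Rightarrow> real" where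
  "stock_residual X a s t n \<omega> = X t \<omega> - X 0 \<omega>
    - (\<Sum>j<n. X (real j * t / real n) \<omega> * (a * (t / real n)
        + s * (V (real (Suc j) * t / real n) \<omega> - V (real j * t / real n) \<omega>)))"

lemma stock_residual_measurable:
  assumes X: "\<And>t. 0 \<le> t \<Longrightarrow> t \<le> T \<Longrightarrow> X t \<in> borel_measurable M" and t: "0 < t" "t \<le> T"
  shows "stock_residual X a s t n \<in> borel_measurable M"
proof -
  have [measurable]: "X t \<in> borel_measurable M" "X 0 \<in> borel_measurable M"
    using t by (auto intro: X)
  have "(\<lambda>\<omega>. X (real j * t / real n) \<omega> * (a * (t / real n)
        + s * (V (real (Suc j) * t / real n) \<omega> - V (real j * t / real n) \<omega>))) \<in> borel_measurable M" if "j < n" for j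
    using grid[OF t that] by (intro borel_measurable_times borel_measurable_add borel_measurable_diff
      borel_measurable_const X V_M) auto
  then show ?thesis
    unfolding stock_residual_def[abs_def] by (intro borel_measurable_diff borel_measurable_sum) auto
qed

lemma ito_null_in_prob:
  assumes I: "has_ito_integral M Y V t I" and t: "0 < t"
    and meas: "\<And>n. (\<lambda>\<omega>. I \<omega>
      - (\<Sum>j<n. Y (real j * t / real n) \<omega> * (V (real (Suc j) * t / real n) \<omega> - V (real j * t / real n) \<omega>))) \<in> borel_measurable M"
  shows "null_in_prob M (\<lambda>n \<omega>. I \<omega>
    - (\<Sum>j<n. Y (real j * t / real n) \<omega> * (V (real (Suc j) * t / real n) \<omega> - V (real j * t / real n) \<omega>)))"
    (is "null_in_prob M ?J")
  unfolding null_in_prob_def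
proof (intro allI impI LIMSEQ_I)
  fix \<epsilon> e :: real assume e: "0 < \<epsilon>" "0 < e"
  \<comment> \<open>In \<open>has_ito_integral\<close> one number bounds both the size of the
    deviation and its probability, hence the minimum.\<close>
  define \<epsilon>' where "\<epsilon>' = min \<epsilon> e"
  have "0 < \<epsilon>'" using e by (simp add: \<epsilon>'_def)
  then have "\<exists>\<delta>>0. \<forall>n u. u 0 = 0 \<and> u n = t \<and> (\<forall>k<n. u k \<le> u (Suc k) \<and> u (Suc k) - u k < \<delta>) \<longrightarrow>
      prob {\<omega> \<in> space M. \<epsilon>' < \<bar>(\<Sum>k<n. Y (u k) \<omega> * (V (u (Suc k)) \<omega> - V (u k) \<omega>)) - I \<omega>\<bar>} < \<epsilon>'"
    by (rule conjunct2[OF I[unfolded has_ito_integral_def], THEN spec, THEN mp])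
  then obtain \<delta> where \<delta>: "0 < \<delta>" and *: "\<And>n u. u 0 = 0 \<Longrightarrow> u n = t \<Longrightarrow> (\<forall>k<n. u k \<le> u (Suc k) \<and> u (Suc k) - u k < \<delta>) \<Longrightarrow>
      prob {\<omega> \<in> space M. \<epsilon>' < \<bar>(\<Sum>k<n. Y (u k) \<omega> * (V (u (Suc k)) \<omega> - V (u k) \<omega>)) - I \<omega>\<bar>} < \<epsilon>'"
    by blast
  obtain n0 :: nat where n0: "t / \<delta> < real n0"
    using reals_Archimedean2 by blast
  show "\<exists>no. \<forall>n\<ge>no. norm (prob {\<omega> \<in> space M. \<epsilon> < \<bar>?J n \<omega>\<bar>} - 0) < e"
  proof (intro exI[of _ "max 1 n0"] allI impI)
    fix n assume "max 1 n0 \<le> n"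
    then have n: "0 < n" "t / real n < \<delta>"
      using n0 \<delta> t by (auto simp: field_simps intro: less_le_trans)
    define u where "u j = real j * t / real n" for j :: nat
    have "prob {\<omega> \<in> space M. \<epsilon>' < \<bar>(\<Sum>k<n. Y (u k) \<omega> * (V (u (Suc k)) \<omega> - V (u k) \<omega>)) - I \<omega>\<bar>} < \<epsilon>'"
    proof (rule *)
      have "u (Suc k) - u k = t / real n" for k
        using n by (simp add: u_def field_simps)
      then show "\<forall>k<n. u k \<le> u (Suc k) \<and> u (Suc k) - u k < \<delta>"
        using n t by (metis diff_ge_0_iff_ge divide_nonneg_nonneg less_imp_le of_nat_0_le_iff)
    qed (use n in \<open>auto simp: u_def\<close>)
    also have "{\<omega> \<in> space M. \<epsilon>' < \<bar>(\<Sum>k<n. Y (u k) \<omega> * (V (u (Suc k)) \<omega> - V (u k) \<omega>)) - I \<omega>\<bar>}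
        = {\<omega> \<in> space M. \<epsilon>' < \<bar>?J n \<omega>\<bar>}"
      unfolding u_def by (simp only: abs_minus_commute)
    finally have 1: "prob {\<omega> \<in> space M. \<epsilon>' < \<bar>?J n \<omega>\<bar>} < \<epsilon>'" .
    have "prob {\<omega> \<in> space M. \<epsilon> < \<bar>?J n \<omega>\<bar>} \<le> prob {\<omega> \<in> space M. \<epsilon>' < \<bar>?J n \<omega>\<bar>}"
    proof (rule finite_measure_mono)
      show "{\<omega> \<in> space M. \<epsilon> < \<bar>?J n \<omega>\<bar>} \<subseteq> {\<omega> \<in> space M. \<epsilon>' < \<bar>?J n \<omega>\<bar>}"
        by (auto simp: \<epsilon>'_def)
      show "{\<omega> \<in> space M. \<epsilon>' < \<bar>?J n \<omega>\<bar>} \<in> sets M"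
        by (rule borel_measurable_less[OF borel_measurable_const borel_measurable_abs[OF meas]])
    qed
    with 1 show "norm (prob {\<omega> \<in> space M. \<epsilon> < \<bar>?J n \<omega>\<bar>} - 0) < e"
      by (simp add: \<epsilon>'_def)
  qed
qed

lemma stock_M:
  assumes "black_scholes_stock M F T a s x0 V X" "0 \<le> t" "t \<le> T"
  shows "X t \<in> borel_measurable (F t)" "X t \<in> borel_measurable M"
  using assms F_le[of "X t" t] unfolding black_scholes_stock_def adapted_def by auto

lemma stock_residual_null:
  assumes X: "black_scholes_stock M F T a s x0 V X" and t: "0 < t" "t \<le> T"
  shows "null_in_prob M (stock_residual X a s t)"
proof -
  have "\<exists>I. has_ito_integral M (\<lambda>u \<omega>. X u \<omega> * s) V t I \<and>
        (AE \<omega> in M. X t \<omega> = X 0 \<omega> + integral {0..t} (\<lambda>u. X u \<omega> * a) + I \<omega>)"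
    using X t unfolding black_scholes_stock_def by auto
  then obtain I where I: "has_ito_integral M (\<lambda>u \<omega>. X u \<omega> * s) V t I"
    "AE \<omega> in M. X t \<omega> = X 0 \<omega> + integral {0..t} (\<lambda>u. X u \<omega> * a) + I \<omega>"
    by blast
  have IM[measurable]: "I \<in> borel_measurable M"
    using I(1) unfolding has_ito_integral_def by blast
  have [measurable]: "X t \<in> borel_measurable M" "X 0 \<in> borel_measurable M"
    using t by (auto intro!: stock_M[OF X])
  have cont: "AE \<omega> in M. continuous_on {0..T} (\<lambda>t. X t \<omega>)"
    using X unfolding black_scholes_stock_def by blast
  \<comment> \<open>The residual is split in two. \<open>R\<close> carries the drift: almost surely
    it is the time integral minus its Riemann sum, and it tends to 0 along each path. Writing it
    with \<open>I\<close> in place of the time integral makes its measurability immediate.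
    \<open>J\<close> carries the Ito sums, which converge only in probability.\<close>
  define R where "R n \<omega> = X t \<omega> - X 0 \<omega> - I \<omega> - (\<Sum>j<n. (X (real j * t / real n) \<omega> * a) * (t / real n))" for n \<omega>
  define J where "J n \<omega> = I \<omega> - (\<Sum>j<n. (X (real j * t / real n) \<omega> * s) * (V (real (Suc j) * t / real n) \<omega> - V (real j * t / real n) \<omega>))" for n \<omega>
  have RM: "R n \<in> borel_measurable M" for n
    unfolding R_def[abs_def] using t grid[OF t]
    by (intro borel_measurable_diff borel_measurable_sum borel_measurable_times borel_measurable_const stock_M[OF X]) auto
  have JM: "J n \<in> borel_measurable M" for n
    unfolding J_def[abs_def] using t grid[OF t]
    by (intro borel_measurable_diff borel_measurable_sum borel_measurable_times borel_measurable_const stock_M[OF X] V_M IM) auto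
  have J: "null_in_prob M J"
    using ito_null_in_prob[OF I(1) t(1)] JM unfolding J_def[abs_def] by simp
  have R: "null_in_prob M R"
  proof (rule AE_tendsto_null_in_prob[OF _ RM])
    show "AE \<omega> in M. (\<lambda>n. R n \<omega>) \<longlonglongrightarrow> 0"
      using I(2) cont
    proof eventually_elim
      case (elim \<omega>)
      have "continuous_on {0..t} (\<lambda>u. X u \<omega> * a)"
        using elim(2) t by (intro continuous_intros continuous_on_subset[OF elim(2)]) auto
      note r = riemann_sums_tendsto[OF this t(1)]
      have "R n \<omega> = integral {0..t} (\<lambda>u. X u \<omega> * a) - (\<Sum>j<n. (X (real j * t / real n) \<omega> * a) * (t / real n))" for n
        unfolding R_def using elim(1) by linarith
      then show ?case
        using tendsto_diff[OF tendsto_const r, of "integral {0..t} (\<lambda>u. X u \<omega> * a)"] by simp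
    qed
  qed
  have "stock_residual X a s t = (\<lambda>n \<omega>. R n \<omega> + J n \<omega>)"
    by (auto simp: fun_eq_iff stock_residual_def R_def J_def sum.distrib[symmetric] algebra_simps)
  then show ?thesis
    using null_in_prob_add[OF R J RM JM] by simp
qed

lemma stock_residual_diff:
  "stock_residual (\<lambda>t \<omega>. X t \<omega> - Y t \<omega>) a s t n \<omega> = stock_residual X a s t n \<omega> - stock_residual Y a s t n \<omega>"
  by (simp add: stock_residual_def sum_subtractf[symmetric] algebra_simps sum.distrib[symmetric])

text \<open>A substitute for stopping at the first exit from \<open>[-R, R]\<close>: only rational times are inspected, which
  keeps the process adapted and loses nothing for continuous paths.\<close>

definition truncated :: "real \<Rightarrow> (real \<Rightarrow> 'a \<Rightarrow> real) \<Rightarrow> real \<Rightarrow> 'a \<Rightarrow> real" where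
  "truncated R D t \<omega> = (if \<bar>D t \<omega>\<bar> \<le> R \<and> (\<forall>q\<in>\<rat> \<inter> {0..<t}. \<bar>D q \<omega>\<bar> \<le> R) then D t \<omega> else 0)"

lemma truncated_le: "0 \<le> R \<Longrightarrow> \<bar>truncated R D t \<omega>\<bar> \<le> R"
  by (auto simp: truncated_def)

lemma truncated_F:
  assumes D: "\<And>t. 0 \<le> t \<Longrightarrow> t \<le> T \<Longrightarrow> D t \<in> borel_measurable (F t)" and t: "0 \<le> t" "t \<le> T"
  shows "truncated R D t \<in> borel_measurable (F t)"
proof -
  have [measurable]: "D t \<in> borel_measurable (F t)" using D t by blast
  have q: "Measurable.pred (F t) (\<lambda>\<omega>. \<bar>D q \<omega>\<bar> \<le> R)" if "q \<in> \<rat> \<inter> {0..<t}" for q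
  proof -
    have [measurable]: "D q \<in> borel_measurable (F t)"
      by (rule F_mono[of q]) (use that t D[of q] in auto)
    show ?thesis by measurable
  qed
  have "countable (\<rat> \<inter> {0..<t})"
    by (intro countable_Int1 countable_rat)
  then have "Measurable.pred (F t) (\<lambda>\<omega>. \<forall>q\<in>\<rat> \<inter> {0..<t}. \<bar>D q \<omega>\<bar> \<le> R)"
    using q by (intro measurable_pred_countable)
  moreover have "Measurable.pred (F t) (\<lambda>\<omega>. \<bar>D t \<omega>\<bar> \<le> R)"
    by measurable
  ultimately have "{\<omega> \<in> space (F t). \<bar>D t \<omega>\<bar> \<le> R \<and> (\<forall>q\<in>\<rat> \<inter> {0..<t}. \<bar>D q \<omega>\<bar> \<le> R)} \<in> sets (F t)"
    unfolding pred_def by (intro sets.sets_Collect_conj)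
  then show ?thesis
    unfolding truncated_def[abs_def] by (intro measurable_If) auto
qed

text \<open>If \<open>D\<close> exceeded the level \<open>R\<close> at \<open>u\<close>, continuity
  would give a slightly later rational time below \<open>t\<close> with the same property, and that
  time would have forced the truncated value at \<open>t\<close> to 0. So a nonzero value at
  \<open>t\<close> certifies that nothing was cut before.\<close>

lemma truncated_eq:
  assumes cont: "continuous_on {0..T} (\<lambda>t. D t \<omega>)" and t: "t \<le> T" and u: "0 \<le> u" "u < t"
    and nz: "truncated R D t \<omega> \<noteq> 0"
  shows "truncated R D u \<omega> = D u \<omega>"
proof -
  have R: "\<forall>q\<in>\<rat> \<inter> {0..<t}. \<bar>D q \<omega>\<bar> \<le> R"
    using nz by (auto simp: truncated_def split: if_splits)
  have "\<bar>D u \<omega>\<bar> \<le> R"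
  proof (rule ccontr)
    assume "\<not> \<bar>D u \<omega>\<bar> \<le> R"
    then have "0 < \<bar>D u \<omega>\<bar> - R" by simp
    moreover have "u \<in> {0..T}" using u t by simp
    ultimately obtain \<delta> where \<delta>: "0 < \<delta>" "\<And>v. v \<in> {0..T} \<Longrightarrow> dist v u < \<delta> \<Longrightarrow> dist (D v \<omega>) (D u \<omega>) < \<bar>D u \<omega>\<bar> - R"
      using cont unfolding continuous_on_iff by metis
    \<comment> \<open>Taken to the right of \<open>u\<close> and still below \<open>t\<close>, so
      that \<open>u = 0\<close> causes no trouble.\<close>
    obtain q where q: "q \<in> \<rat>" "u < q" "q < min t (u + \<delta>)"
      using Rats_dense_in_real[of u "min t (u + \<delta>)"] u \<delta> by auto
    then have "dist (D q \<omega>) (D u \<omega>) < \<bar>D u \<omega>\<bar> - R"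
      using u t by (intro \<delta>(2)) (auto simp: dist_real_def)
    moreover have "\<bar>D q \<omega>\<bar> \<le> R" using R q u by auto
    ultimately show False by (simp add: dist_real_def)
  qed
  then show ?thesis using R u by (auto simp: truncated_def)
qed

text \<open>Gronwall's inequality in iterated form. The time stays arbitrary in the induction on k,
  because the bound at \<open>t\<close> uses the bounds at all grid points below \<open>t\<close>.
  Their k-th powers, weighted by the mesh, sum to at most t^(k+1) / (k+1).\<close>

lemma truncated_L2_bound:
  assumes D: "\<And>t. 0 \<le> t \<Longrightarrow> t \<le> T \<Longrightarrow> D t \<in> borel_measurable (F t)"
    and cont: "AE \<omega> in M. continuous_on {0..T} (\<lambda>t. D t \<omega>)"
    and D0: "AE \<omega> in M. D 0 \<omega> = 0"
    and res: "\<And>t. 0 < t \<Longrightarrow> t \<le> T \<Longrightarrow> null_in_prob M (stock_residual D a s t)"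
    and R: "0 \<le> R" and t: "0 \<le> t" "t \<le> T"
  shows "expectation (\<lambda>\<omega>. (truncated R D t \<omega>)\<^sup>2) \<le> R\<^sup>2 * (4 * (2 * a\<^sup>2 * T + s\<^sup>2) * t) ^ k / fact k"
  using t
proof (induction k arbitrary: t)
  case 0
  have sq: "(truncated R D t \<omega>)\<^sup>2 \<le> R\<^sup>2" for \<omega>
    using truncated_le[OF R, of D t \<omega>] R by (simp add: abs_le_square_iff[symmetric])
  have "expectation (\<lambda>\<omega>. (truncated R D t \<omega>)\<^sup>2) \<le> expectation (\<lambda>_. R\<^sup>2)"
    by (rule integral_mono') (use sq in auto)
  then show ?case by (simp add: prob_space)
next
  case (Suc k)
  define C where "C = 2 * a\<^sup>2 * T + s\<^sup>2"
  have C: "0 \<le> C" using Suc.prems by (simp add: C_def)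
  define z where "z = truncated R D"
  have zF: "z t \<in> borel_measurable (F t)" if "0 \<le> t" "t \<le> T" for t
    unfolding z_def using D that by (rule truncated_F)
  have zM: "z t \<in> borel_measurable M" if "0 \<le> t" "t \<le> T" for t
    using zF[OF that] by (rule F_le)
  have z2: "integrable M (\<lambda>\<omega>. (z t \<omega>)\<^sup>2)" if "0 \<le> t" "t \<le> T" for t
  proof (rule integrable_const_bound[where B = "R\<^sup>2"])
    show "AE \<omega> in M. norm ((z t \<omega>)\<^sup>2) \<le> R\<^sup>2"
      using truncated_le[OF R, of D t] R by (auto simp: z_def abs_le_square_iff[symmetric])
    show "(\<lambda>\<omega>. (z t \<omega>)\<^sup>2) \<in> borel_measurable M"
      using zM[OF that] by simp
  qed
  show ?case
  \<comment> \<open>A grid needs positive length; at time 0 the claim is the initial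
    condition.\<close>
  proof (cases "t = 0")
    case True
    have "AE \<omega> in M. (z 0 \<omega>)\<^sup>2 = 0"
      using D0 by eventually_elim (simp add: z_def truncated_def)
    then have "expectation (\<lambda>\<omega>. (z 0 \<omega>)\<^sup>2) = 0"
      by (rule integral_eq_zero_AE)
    then show ?thesis using True by (simp add: z_def)
  next
    case False
    with Suc.prems have t: "0 < t" "t \<le> T" by auto
    define u where "u n j = real j * t / real n" for n j :: nat
    note g = grid[OF t, folded u_def]
    define L where "L n \<omega> = (\<Sum>j<n. z (u n j) \<omega> * (a * (t / real n) + s * (V (u n (Suc j)) \<omega> - V (u n j) \<omega>)))" for n \<omega>
    \<comment> \<open>Half of the bound to be shown, since \<open>L2_le_of_null_in_prob\<close>
      doubles it.\<close>
    define B where "B = R\<^sup>2 * (4 * C * t) ^ Suc k / (2 * fact (Suc k))"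
    have L: "integrable M (\<lambda>\<omega>. (L n \<omega>)\<^sup>2) \<and> expectation (\<lambda>\<omega>. (L n \<omega>)\<^sup>2) \<le> B" if n: "0 < n" for n
    proof -
      define h where "h = t / real n"
      have h: "0 < h" "h \<le> T" "real n * h = t" "real n * (a * h)\<^sup>2 = h * (a\<^sup>2 * t)"
        using t n by (auto simp: h_def field_simps power2_eq_square intro: order_trans)
      have mv: "integrable M (\<lambda>\<omega>. (a * h + s * (V (u n (Suc j)) \<omega> - V (u n j) \<omega>))\<^sup>2)"
        "expectation (\<lambda>\<omega>. a * h + s * (V (u n (Suc j)) \<omega> - V (u n j) \<omega>)) = a * h"
        "expectation (\<lambda>\<omega>. (a * h + s * (V (u n (Suc j)) \<omega> - V (u n j) \<omega>))\<^sup>2) = (a * h)\<^sup>2 + s\<^sup>2 * h" if "j < n" for j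
        using integrable_euler_incr[OF g(1-3)[OF that], of "a * h" s] expectation_euler_incr[OF g(1-3)[OF that], of "a * h" s]
          expectation_euler_incr2[OF g(1-3)[OF that], of "a * h" s] unfolding g(6)[OF that] h_def by auto
      note S = sum_incr_L2[where n = n and u = "u n" and h = "\<lambda>j. z (u n j)" and \<psi> = "\<lambda>x. a * h + s * x"
          and m = "a * h" and v = "(a * h)\<^sup>2 + s\<^sup>2 * h"]
      have 1: "integrable M (\<lambda>\<omega>. (L n \<omega>)\<^sup>2)"
        unfolding L_def h_def[symmetric] by (rule S(1)) (use g mv in \<open>auto intro!: zF z2\<close>)
      have "expectation (\<lambda>\<omega>. (L n \<omega>)\<^sup>2) \<le> 2 * (real n * (a * h)\<^sup>2 + ((a * h)\<^sup>2 + s\<^sup>2 * h))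
          * (\<Sum>j<n. expectation (\<lambda>\<omega>. (z (u n j) \<omega>)\<^sup>2))"
        unfolding L_def h_def[symmetric] by (rule S(2)) (use g mv in \<open>auto intro!: zF z2\<close>)
      also have "\<dots> \<le> (2 * h * C) * (\<Sum>j<n. R\<^sup>2 * (4 * C * u n j) ^ k / fact k)"
      proof (rule mult_mono)
        \<comment> \<open>With \<open>h\<close> factored out, the squared mean and the second moment
          of an Euler step contribute one drift term each. Both are at most
          \<open>a\<^sup>2 * T\<close>, whence the \<open>2 * a\<^sup>2 * T\<close> in
          \<open>C\<close>.\<close>
        have "a\<^sup>2 * t + a\<^sup>2 * h \<le> a\<^sup>2 * T + a\<^sup>2 * T"
          using t h by (intro add_mono mult_left_mono) auto
        then have "a\<^sup>2 * t + a\<^sup>2 * h + s\<^sup>2 \<le> C"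
          unfolding C_def by linarith
        then have "h * (a\<^sup>2 * t + a\<^sup>2 * h + s\<^sup>2) \<le> h * C"
          using h(1) by (intro mult_left_mono) auto
        then show "2 * (real n * (a * h)\<^sup>2 + ((a * h)\<^sup>2 + s\<^sup>2 * h)) \<le> 2 * h * C"
          unfolding h(4) by (simp add: power2_eq_square algebra_simps)
        show "(\<Sum>j<n. expectation (\<lambda>\<omega>. (z (u n j) \<omega>)\<^sup>2)) \<le> (\<Sum>j<n. R\<^sup>2 * (4 * C * u n j) ^ k / fact k)"
          unfolding C_def z_def by (intro sum_mono Suc.IH) (use g in auto)
        show "0 \<le> 2 * h * C" using h C by simp
        show "0 \<le> (\<Sum>j<n. expectation (\<lambda>\<omega>. (z (u n j) \<omega>)\<^sup>2))"
          by (intro sum_nonneg integral_nonneg_AE) auto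
      qed
      also have "\<dots> = (2 * h * C * R\<^sup>2 * (4 * C * h) ^ k / fact k) * (\<Sum>j<n. real j ^ k)"
        by (simp add: u_def h_def sum_distrib_left sum_divide_distrib power_mult_distrib power_divide algebra_simps)
      \<comment> \<open>The division by \<open>Suc k\<close> turns \<open>fact k\<close> into
        \<open>fact (Suc k)\<close>, and the powers of n and h will combine to powers of
        \<open>real n * h = t\<close>.\<close>
      also have "\<dots> \<le> (2 * h * C * R\<^sup>2 * (4 * C * h) ^ k / fact k) * (real n ^ Suc k / real (Suc k))"
      proof (rule mult_left_mono)
        show "(\<Sum>j<n. real j ^ k) \<le> real n ^ Suc k / real (Suc k)"
          using sum_power_le[of k n] by (simp add: field_simps)
        show "0 \<le> 2 * h * C * R\<^sup>2 * (4 * C * h) ^ k / fact k"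
          using h C by simp
      qed
      also have "\<dots> = R\<^sup>2 * (4 * C * (real n * h)) ^ Suc k / (2 * fact (Suc k))"
      proof -
        define x where "x = 4 * C * h"
        have *: "2 * h * C = x / 2" "4 * C * (real n * h) = x * real n" by (simp_all add: x_def)
        show ?thesis
          unfolding * x_def[symmetric] by (simp add: power_mult_distrib mult_ac)
      qed
      also have "\<dots> = B" unfolding h(3) B_def ..
      finally show ?thesis using 1 by simp
    qed
    have "expectation (\<lambda>\<omega>. (z t \<omega>)\<^sup>2) \<le> 2 * B"
    proof (rule L2_le_of_null_in_prob[where L = L and X = "stock_residual D a s t" and R = R])
      show "AE \<omega> in M. \<forall>n>0. z t \<omega> \<noteq> 0 \<longrightarrow> z t \<omega> = L n \<omega> + stock_residual D a s t n \<omega>"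
        using D0 cont
      proof eventually_elim
        case (elim \<omega>)
        show ?case
        proof (intro allI impI)
          fix n :: nat assume n: "0 < n" and nz: "z t \<omega> \<noteq> 0"
          then have zt: "z t \<omega> = D t \<omega>" by (auto simp: z_def truncated_def split: if_splits)
          have "z (u n j) \<omega> = D (u n j) \<omega>" if "j < n" for j
            unfolding z_def
            by (rule truncated_eq[where t = t and D = D and R = R, OF elim(2) t(2)]) (use g[OF that] nz in \<open>auto simp: z_def\<close>)
          then show "z t \<omega> = L n \<omega> + stock_residual D a s t n \<omega>"
            unfolding zt stock_residual_def L_def u_def[symmetric] using elim(1) by simp
        qed
      qed
      show "stock_residual D a s t n \<in> borel_measurable M" for n
        by (rule stock_residual_measurable[OF _ t]) (use F_le D in blast)
    qed (use L zM[of t] t truncated_le[OF R] res[OF t] in \<open>auto simp: z_def\<close>)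
    then show ?thesis by (simp add: z_def B_def C_def)
  qed
qed

text \<open>Letting k tend to infinity in the iterated bound shows that the truncations of the
  difference at all natural levels vanish at \<open>T\<close>, outside a single null set as the
  levels are countable. A continuous path on \<open>{0..T}\<close> is bounded, so at a high enough
  level nothing is cut and the difference itself is 0.\<close>

lemma stock_eq_geom:
  assumes X: "black_scholes_stock M F T a s x0 V X" and T: "0 < T"
  shows "AE \<omega> in M. X T \<omega> = x0 * exp ((a - s\<^sup>2 / 2) * T + s * V T \<omega>)"
proof -
  define G where "G = geom x0 a s"
  define D where "D = (\<lambda>t \<omega>. X t \<omega> - G t \<omega>)"
  have GM: "G t \<in> borel_measurable M" if "0 \<le> t" "t \<le> T" for t
    unfolding G_def using geom_F[OF that] by (rule F_le)
  have D: "D t \<in> borel_measurable (F t)" if "0 \<le> t" "t \<le> T" for t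
    unfolding D_def G_def using stock_M(1)[OF X that] geom_F[OF that] by simp
  have "AE \<omega> in M. continuous_on {0..T} (\<lambda>t. X t \<omega>)" "AE \<omega> in M. X 0 \<omega> = x0"
    using X unfolding black_scholes_stock_def by auto
  with paths start have cont: "AE \<omega> in M. continuous_on {0..T} (\<lambda>t. D t \<omega>)" and D0: "AE \<omega> in M. D 0 \<omega> = 0"
    by (auto simp: D_def G_def geom_def elim!: eventually_elim2 intro!: continuous_intros)
  have res: "null_in_prob M (stock_residual D a s t)" if t: "0 < t" "t \<le> T" for t
  proof -
    have "null_in_prob M (stock_residual G a s t)"
      using geom_euler[OF t, of x0 a s] by (simp add: G_def stock_residual_def[abs_def])
    then have "null_in_prob M (\<lambda>n \<omega>. - stock_residual G a s t n \<omega>)"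
      by (simp add: null_in_prob_def)
    from null_in_prob_add[OF stock_residual_null[OF X t] this]
    have "null_in_prob M (\<lambda>n \<omega>. stock_residual X a s t n \<omega> + - stock_residual G a s t n \<omega>)"
      using stock_residual_measurable[OF _ t] stock_M(2)[OF X] GM by simp
    then show ?thesis
      unfolding D_def stock_residual_diff[abs_def, of X G] by simp
  qed
  have "AE \<omega> in M. truncated (real R) D T \<omega> = 0" for R
  proof -
    have "(\<lambda>k. y ^ k / fact k) \<longlonglongrightarrow> 0" for y :: real
      using summable_LIMSEQ_zero[OF summable_exp[of y]] by (simp add: divide_inverse mult.commute)
    then have "(\<lambda>k. (real R)\<^sup>2 * ((4 * (2 * a\<^sup>2 * T + s\<^sup>2) * T) ^ k / fact k)) \<longlonglongrightarrow> (real R)\<^sup>2 * 0"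
      by (intro tendsto_mult_left)
    moreover have "expectation (\<lambda>\<omega>. (truncated (real R) D T \<omega>)\<^sup>2)
        \<le> (real R)\<^sup>2 * ((4 * (2 * a\<^sup>2 * T + s\<^sup>2) * T) ^ k / fact k)" for k
      using truncated_L2_bound[OF D cont D0 res, of "real R" T k] T by simp
    ultimately have le: "expectation (\<lambda>\<omega>. (truncated (real R) D T \<omega>)\<^sup>2) \<le> 0"
      by (intro tendsto_lowerbound[of _ _ sequentially]) auto
    have tm[measurable]: "truncated (real R) D T \<in> borel_measurable M"
      by (rule F_le, rule truncated_F[OF D]) (use T in auto)
    have int: "integrable M (\<lambda>\<omega>. (truncated (real R) D T \<omega>)\<^sup>2)"
      using truncated_le[of "real R" D T]
      by (intro integrable_const_bound[where B = "(real R)\<^sup>2"]) (auto simp: abs_le_square_iff[symmetric])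
    have "expectation (\<lambda>\<omega>. (truncated (real R) D T \<omega>)\<^sup>2) = 0"
      using le by (intro antisym integral_nonneg_AE) auto
    then have "AE \<omega> in M. (truncated (real R) D T \<omega>)\<^sup>2 = 0"
      using integral_nonneg_eq_0_iff_AE[OF int] by simp
    then show ?thesis by simp
  qed
  then have "AE \<omega> in M. \<forall>R. truncated (real R) D T \<omega> = 0"
    by (simp add: AE_all_countable)
  then have "AE \<omega> in M. D T \<omega> = 0"
    using cont
  proof eventually_elim
    case (elim \<omega>)
    have "bounded ((\<lambda>t. D t \<omega>) ` {0..T})"
      using elim(2) by (intro compact_imp_bounded compact_continuous_image) auto
    then have "\<exists>b. \<forall>t\<in>{0..T}. \<bar>D t \<omega>\<bar> \<le> b"
      unfolding bounded_iff by auto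
    then obtain b where b: "\<And>t. t \<in> {0..T} \<Longrightarrow> \<bar>D t \<omega>\<bar> \<le> b"
      by blast
    obtain R :: nat where "b \<le> real R" using real_arch_simple by blast
    then have "\<bar>D t \<omega>\<bar> \<le> real R" if "t \<in> {0..T}" for t
      using b[OF that] by linarith
    then have "truncated (real R) D T \<omega> = D T \<omega>"
      using T by (auto simp: truncated_def)
    then show ?case using elim(1) by metis
  qed
  then show ?thesis by (simp add: D_def G_def geom_def)
qed

end

section \<open>Components of the planar Wiener process\<close>

abbreviation vec_pair :: "real^2 \<Rightarrow> real \<times> real" where
  "vec_pair z \<equiv> (z $ 1, z $ 2)"

lemma vec_pair_vector: "z = vector [z $ 1, z $ 2]" for z :: "real^2"
  by (simp add: vec_eq_iff forall_2)

lemma borel_measurable_vec_pair: "vec_pair \<in> borel_measurable borel"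
  by (intro borel_measurable_continuous_onI continuous_intros)

text \<open>Coordinates carry boxes to boxes of the same volume, and these volumes determine
  \<open>lborel\<close>. The passage is wanted because the process lives in \<open>real^2\<close>,
  while the densities of the theorem and Fubini's theorem live on pairs.\<close>

lemma distr_lborel_vec_pair: "distr lborel lborel vec_pair = lborel"
proof (rule lborel_eqI[symmetric])
  fix l u :: "real \<times> real" assume le: "\<And>b. b \<in> Basis \<Longrightarrow> l \<bullet> b \<le> u \<bullet> b"
  let ?l = "vector [fst l, snd l] :: real^2" and ?u = "vector [fst u, snd u] :: real^2"
  have le2: "fst l \<le> fst u" "snd l \<le> snd u"
    using le[of "(1, 0)"] le[of "(0, 1)"] by (auto simp: Basis_prod_def inner_prod_def)
  have le3: "?l $ i \<le> ?u $ i" for i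
    using exhaust_2[of i] le2 by auto
  have "emeasure (distr lborel lborel vec_pair) (box l u) = emeasure lborel (vec_pair -` box l u)"
    using borel_measurable_vec_pair by (subst emeasure_distr) auto
  also have "vec_pair -` box l u = box ?l ?u"
    by (auto simp: mem_box Basis_vec_def Basis_prod_def inner_prod_def inner_axis forall_2)
  also have "emeasure lborel \<dots> = ennreal (\<Prod>b\<in>Basis. (?u - ?l) \<bullet> b)"
    by (rule emeasure_lborel_box) (use le3 in \<open>auto simp: Basis_vec_def inner_axis\<close>)
  also have "(\<Prod>b\<in>Basis. (?u - ?l) \<bullet> b) = (fst u - fst l) * (snd u - snd l)"
  proof -
    have B: "(Basis :: (real^2) set) = {axis 1 1, axis 2 1}"
      by (auto simp: Basis_vec_def UNIV_2)
    have "axis 1 1 \<noteq> (axis 2 1 :: real^2)"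
      by (simp add: axis_eq_axis)
    then show ?thesis
      unfolding B by (subst prod.insert) (auto simp: inner_axis)
  qed
  also have "\<dots> = (\<Prod>b\<in>Basis. (u - l) \<bullet> b)"
    by (simp add: Basis_prod_def inner_prod_def)
  finally show "emeasure (distr lborel lborel vec_pair) (box l u) = ennreal (\<Prod>b\<in>Basis. (u - l) \<bullet> b)" .
qed simp

lemma distributed_vec_pair:
  assumes "distributed M lborel X f"
  shows "distributed M lborel (\<lambda>\<omega>. vec_pair (X \<omega>)) (\<lambda>(x, y). f (vector [x, y]))"
  unfolding distributed_def
proof (intro conjI)
  have D: "distr M lborel X = density lborel f" and f[measurable]: "f \<in> borel_measurable borel"
    and X[measurable]: "X \<in> borel_measurable M"
    using assms by (auto simp: distributed_def)
  have v: "(\<lambda>(x, y). vector [x, y] :: real^2) \<in> borel_measurable borel"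
  proof (intro borel_measurable_continuous_onI)
    have "continuous_on UNIV (\<lambda>z::real \<times> real. vector [fst z, snd z] :: real^2)"
    proof (subst continuous_on_componentwise, safe)
      fix i :: "real^2" assume "i \<in> Basis"
      then have "i = axis 1 1 \<or> i = axis 2 1"
        by (auto simp: Basis_vec_def) (metis exhaust_2)
      then have "(\<lambda>z::real \<times> real. (vector [fst z, snd z] :: real^2) \<bullet> i) = fst
          \<or> (\<lambda>z::real \<times> real. (vector [fst z, snd z] :: real^2) \<bullet> i) = snd"
        by (auto simp: inner_axis)
      then show "continuous_on UNIV (\<lambda>z::real \<times> real. (vector [fst z, snd z] :: real^2) \<bullet> i)"
        by (elim disjE) (simp_all only: continuous_on_fst continuous_on_snd continuous_on_id)
    qed
    then show "continuous_on UNIV (\<lambda>(x, y). vector [x, y] :: real^2)"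
      by (simp add: case_prod_beta)
  qed
  have "(\<lambda>z. f ((\<lambda>(x, y). vector [x, y]) z)) \<in> borel_measurable borel"
    using v f by (rule measurable_compose)
  then show g: "(\<lambda>(x, y). f (vector [x, y])) \<in> borel_measurable lborel"
    by (simp add: case_prod_beta)
  note [measurable] = borel_measurable_vec_pair
  show "(\<lambda>\<omega>. vec_pair (X \<omega>)) \<in> measurable M lborel"
    using measurable_compose[OF X borel_measurable_vec_pair] by simp
  have "distr M lborel (\<lambda>\<omega>. vec_pair (X \<omega>)) = distr (distr M lborel X) lborel vec_pair"
    using borel_measurable_vec_pair by (subst distr_distr) (auto simp: comp_def)
  \<comment> \<open>The density is rewritten as a function of \<open>vec_pair z\<close>, the form in
    which it can be moved across the image measure.\<close>
  also have "\<dots> = distr (density lborel (\<lambda>z. (case vec_pair z of (x, y) \<Rightarrow> f (vector [x, y])))) lborel vec_pair"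
    unfolding D by (simp flip: vec_pair_vector)
  also have "\<dots> = density (distr lborel lborel vec_pair) (\<lambda>(x, y). f (vector [x, y]))"
    using borel_measurable_vec_pair by (intro density_distr[symmetric] g) auto
  also have "\<dots> = density lborel (\<lambda>(x, y). f (vector [x, y]))"
    by (simp only: distr_lborel_vec_pair)
  finally show "distr M lborel (\<lambda>\<omega>. vec_pair (X \<omega>)) = density lborel (\<lambda>(x, y). f (vector [x, y]))" .
qed

section \<open>The planar normal density and its marginals\<close>

lemma matrix_inv_eqI:
  fixes A B :: "real^'n^'n"
  assumes "A ** B = mat 1" "B ** A = mat 1"
  shows "matrix_inv A = B"
  unfolding matrix_inv_def
proof (rule some_equality)
  fix C assume "A ** C = mat 1 \<and> C ** A = mat 1"
  then show "C = B"
    using assms by (metis matrix_mul_assoc matrix_mul_lid matrix_mul_rid)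
qed (use assms in simp)

text \<open>Completing the square in y factors the joint density into the law of the first
  coordinate and the conditional law of the second. Integrating out y then leaves the first
  factor.\<close>

lemma mvnormal_density_corr_matrix:
  assumes h: "0 < h" and \<rho>: "\<bar>\<rho>\<bar> < 1"
  shows "mvnormal_density (h *\<^sub>R corr_matrix \<rho>) (vector [x, y])
    = normal_density 0 (sqrt h) x * normal_density (\<rho> * x) (sqrt (h * (1 - \<rho>\<^sup>2))) y"
proof -
  have r: "0 < 1 - \<rho>\<^sup>2" using \<rho> by (simp add: abs_square_less_1)
  define k where "k = h * (1 - \<rho>\<^sup>2)"
  have k: "0 < k" using h r by (simp add: k_def)
  \<comment> \<open>The explicit inverse of the covariance matrix. Its determinant is
    \<open>h * k\<close>, and \<open>k\<close> is also the conditional variance.\<close>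
  define I :: "real^2^2" where "I = vector [vector [1 / k, - \<rho> / k], vector [- \<rho> / k, 1 / k]]"
  let ?S = "h *\<^sub>R corr_matrix \<rho>"
  have e: "h / k - h * \<rho> * \<rho> / k = 1"
  proof -
    have "h - h * \<rho> * \<rho> = k" by (simp add: k_def power2_eq_square algebra_simps)
    then show ?thesis using k by (simp flip: diff_divide_distrib)
  qed
  have e2: "\<rho> + \<rho> * (\<rho> * (\<rho> * h)) / k = \<rho> * h / k"
  proof -
    have "\<rho> * h / k = \<rho> * (h / k - h * \<rho> * \<rho> / k) + \<rho> * (\<rho> * (\<rho> * h)) / k"
      by (simp add: algebra_simps)
    then show ?thesis unfolding e by simp
  qed
  have "?S ** I = mat 1" "I ** ?S = mat 1"
    using e e2 by (simp_all add: vec_eq_iff forall_2 matrix_matrix_mult_def sum_2 corr_matrix_def I_def mat_def field_simps)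
  then have inv: "matrix_inv ?S = I" by (rule matrix_inv_eqI)
  have det: "det ?S = h * k"
    by (simp add: det_2 corr_matrix_def k_def power2_eq_square algebra_simps)
  have q: "vector [x, y] \<bullet> (I *v vector [x, y]) = (x\<^sup>2 - 2 * \<rho> * x * y + y\<^sup>2) / k"
    by (simp add: inner_vec_def sum_2 matrix_vector_mult_def I_def power2_eq_square add_divide_distrib diff_divide_distrib algebra_simps)
  have "(x\<^sup>2 - 2 * \<rho> * x * y + y\<^sup>2) / k = x\<^sup>2 / h + (y - \<rho> * x)\<^sup>2 / k"
    using h r unfolding k_def by (simp add: field_simps power2_eq_square)
  then have ex: "- ((x\<^sup>2 - 2 * \<rho> * x * y + y\<^sup>2) / k) / 2 = - (x - 0)\<^sup>2 / (2 * h) + - (y - \<rho> * x)\<^sup>2 / (2 * k)"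
    by simp
  have sq: "sqrt ((2 * pi) ^ CARD(2) * (h * k)) = sqrt (2 * pi * h) * sqrt (2 * pi * k)"
    unfolding real_sqrt_mult[symmetric] by (simp add: power2_eq_square mult_ac)
  show ?thesis
    unfolding mvnormal_density_def inv det q ex exp_add sq k_def[symmetric] normal_density_def
    using h k by simp
qed

lemma nn_integral_normal_density: "0 < \<sigma> \<Longrightarrow> (\<integral>\<^sup>+x. ennreal (normal_density \<mu> \<sigma> x) \<partial>lborel) = 1"
  using prob_space.emeasure_space_1[OF prob_space_normal_density, of \<sigma> \<mu>]
  by (simp add: emeasure_density)

lemma (in prob_space) distributed_mvnormal_component:
  assumes D: "distributed M lborel X (\<lambda>z. ennreal (mvnormal_density (h *\<^sub>R corr_matrix \<rho>) z))"
    and h: "0 < h" and \<rho>: "\<bar>\<rho>\<bar> < 1"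
  shows "distributed M lborel (\<lambda>\<omega>. X \<omega> $ i) (\<lambda>x. ennreal (normal_density 0 (sqrt h) x))"
proof -
  have k: "0 < h * (1 - \<rho>\<^sup>2)" using h \<rho> by (simp add: abs_square_less_1)
  note P = distributed_vec_pair[OF D]
  have P': "distributed M (lborel \<Otimes>\<^sub>M lborel) (\<lambda>\<omega>. (X \<omega> $ 1, X \<omega> $ 2))
    (\<lambda>(x, y). ennreal (mvnormal_density (h *\<^sub>R corr_matrix \<rho>) (vector [x, y])))"
    using P by (simp add: lborel_prod)
  \<comment> \<open>The quadratic form is symmetric in x and y, so the factorisation also holds with
    the coordinates exchanged; this serves the second marginal.\<close>
  have sym: "mvnormal_density (h *\<^sub>R corr_matrix \<rho>) (vector [x, y])
    = normal_density 0 (sqrt h) y * normal_density (\<rho> * y) (sqrt (h * (1 - \<rho>\<^sup>2))) x" for x y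
  proof -
    have "x\<^sup>2 / (2 * h) + (y - \<rho> * x)\<^sup>2 / (2 * (h * (1 - \<rho>\<^sup>2))) = y\<^sup>2 / (2 * h) + (x - \<rho> * y)\<^sup>2 / (2 * (h * (1 - \<rho>\<^sup>2)))"
      using h k by (simp add: field_simps power2_eq_square)
    then have "exp (- (x\<^sup>2 / (2 * h))) * exp (- ((y - \<rho> * x)\<^sup>2 / (2 * (h * (1 - \<rho>\<^sup>2)))))
       = exp (- (y\<^sup>2 / (2 * h))) * exp (- ((x - \<rho> * y)\<^sup>2 / (2 * (h * (1 - \<rho>\<^sup>2)))))"
      by (simp flip: exp_add)
    then show ?thesis
      unfolding mvnormal_density_corr_matrix[OF h \<rho>] normal_density_def using h k by simp
  qed
  have "(\<integral>\<^sup>+y. ennreal (mvnormal_density (h *\<^sub>R corr_matrix \<rho>) (vector [x, y])) \<partial>lborel)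
      = ennreal (normal_density 0 (sqrt h) x)" for x
    unfolding mvnormal_density_corr_matrix[OF h \<rho>] using k
    by (simp add: ennreal_mult nn_integral_cmult nn_integral_normal_density)
  then have 1: "distributed M lborel (\<lambda>\<omega>. X \<omega> $ 1) (\<lambda>x. ennreal (normal_density 0 (sqrt h) x))"
    using distr_marginal1[OF sigma_finite_lborel sigma_finite_lborel P'] by simp
  have "(\<integral>\<^sup>+x. ennreal (mvnormal_density (h *\<^sub>R corr_matrix \<rho>) (vector [x, y])) \<partial>lborel)
      = ennreal (normal_density 0 (sqrt h) y)" for y
    unfolding sym using k
    by (simp add: ennreal_mult nn_integral_cmult nn_integral_normal_density)
  then have 2: "distributed M lborel (\<lambda>\<omega>. X \<omega> $ 2) (\<lambda>x. ennreal (normal_density 0 (sqrt h) x))"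
    using distr_marginal2[OF sigma_finite_lborel sigma_finite_lborel P'] by simp
  show ?thesis using 1 2 exhaust_2[of i] by auto
qed

text \<open>Events of one coordinate are among the events of the vector increment, so independence
  from \<open>F s\<close> is inherited; the law of the coordinate is a normal marginal.\<close>

lemma scalar_wiener_component:
  assumes M: "prob_space M" and F: "sub_filtration M F" and \<rho>: "\<bar>\<rho>\<bar> < 1"
    and W: "wiener_process M F T (corr_matrix \<rho>) W"
  shows "scalar_wiener M F T (\<lambda>t \<omega>. W t \<omega> $ i)"
proof -
  interpret prob_space M by fact
  have ad: "\<And>t. t \<in> {0..T} \<Longrightarrow> W t \<in> borel_measurable (F t)"
    and st: "AE \<omega> in M. W 0 \<omega> = 0"
    and co: "AE \<omega> in M. continuous_on {0..T} (\<lambda>t. W t \<omega>)"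
    and ind: "\<And>s t. 0 \<le> s \<Longrightarrow> s < t \<Longrightarrow> t \<le> T \<Longrightarrow>
        indep_set (sets (F s)) {(\<lambda>\<omega>. W t \<omega> - W s \<omega>) -` D \<inter> space M | D. D \<in> sets borel}"
    and dis: "\<And>s t. 0 \<le> s \<Longrightarrow> s < t \<Longrightarrow> t \<le> T \<Longrightarrow> distributed M lborel (\<lambda>\<omega>. W t \<omega> - W s \<omega>)
          (\<lambda>z. ennreal (mvnormal_density ((t - s) *\<^sub>R corr_matrix \<rho>) z))"
    using W unfolding wiener_process_def adapted_def by blast+
  show ?thesis
  proof
    show "sub_filtration M F" by fact
    have nth: "(\<lambda>z::real^2. z $ i) \<in> borel_measurable borel"
      by (intro borel_measurable_continuous_onI continuous_intros)
    show "adapted F T (\<lambda>t \<omega>. W t \<omega> $ i)"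
      unfolding adapted_def using measurable_compose[OF ad nth] by auto
    show "AE \<omega> in M. W 0 \<omega> $ i = 0"
      using st by eventually_elim simp
    show "AE \<omega> in M. continuous_on {0..T} (\<lambda>t. W t \<omega> $ i)"
      using co by eventually_elim (intro continuous_intros)
    fix s t :: real assume t: "0 \<le> s" "s < t" "t \<le> T"
    have "{(\<lambda>\<omega>. W t \<omega> $ i - W s \<omega> $ i) -` D \<inter> space M | D. D \<in> sets borel}
      \<subseteq> {(\<lambda>\<omega>. W t \<omega> - W s \<omega>) -` D \<inter> space M | D. D \<in> sets borel}"
    proof safe
      fix D :: "real set" assume "D \<in> sets borel"
      then have "(\<lambda>z::real^2. z $ i) -` D \<in> sets borel"
        using measurable_sets[OF nth, of D] by simp
      then show "\<exists>D'. (\<lambda>\<omega>. W t \<omega> $ i - W s \<omega> $ i) -` D \<inter> space M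
          = (\<lambda>\<omega>. W t \<omega> - W s \<omega>) -` D' \<inter> space M \<and> D' \<in> sets borel"
        by (intro exI[of _ "(\<lambda>z::real^2. z $ i) -` D"]) auto
    qed
    then show "indep_set (sets (F s)) {(\<lambda>\<omega>. W t \<omega> $ i - W s \<omega> $ i) -` D \<inter> space M | D. D \<in> sets borel}"
      using ind[OF t] unfolding indep_sets2_eq by (meson subset_iff)
    show "distributed M lborel (\<lambda>\<omega>. W t \<omega> $ i - W s \<omega> $ i) (\<lambda>x. ennreal (normal_density 0 (sqrt (t - s)) x))"
      using distributed_mvnormal_component[OF dis[OF t] _ \<rho>, of i] t by simp
  qed
qed

section \<open>Absolute continuity of the law of the terminal values\<close>

lemma absolutely_continuous_distrI:
  assumes X: "X \<in> borel_measurable M" and "\<And>N. N \<in> null_sets lborel \<Longrightarrow> AE \<omega> in M. X \<omega> \<notin> N"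
  shows "absolutely_continuous lborel (distr M lborel X)"
  unfolding absolutely_continuous_def
proof
  fix N :: "'b set" assume N: "N \<in> null_sets lborel"
  then have "X -` N \<inter> space M \<in> sets M"
    using measurable_sets[OF X, of N] by auto
  moreover have "X -` N \<inter> space M = {\<omega> \<in> space M. \<not> X \<omega> \<notin> N}" by auto
  ultimately have "X -` N \<inter> space M \<in> null_sets M"
    using assms(2)[OF N] AE_iff_null_sets[of "X -` N \<inter> space M" M] AE_iff_measurable[of "X -` N \<inter> space M" M "\<lambda>\<omega>. X \<omega> \<notin> N"]
    by (auto simp: null_sets_def)
  then show "N \<in> null_sets (distr M lborel X)"
    using N X by (subst null_sets_distr_iff) auto
qed

text \<open>The initial condition turns the increment over \<open>{0..T}\<close>, whose law is
  given, into the terminal value. Null sets are used rather than the Gaussian density because this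
  form passes on to the martingale measure and to the shifted noises.\<close>

lemma wiener_not_in_null_set:
  fixes N :: "(real \<times> real) set"
  assumes W: "wiener_process M F T (corr_matrix \<rho>) W" and T: "0 < T" and N: "N \<in> null_sets lborel"
  shows "AE \<omega> in M. (W T \<omega> $ 1, W T \<omega> $ 2) \<notin> N"
proof -
  have D: "distributed M lborel (\<lambda>\<omega>. W T \<omega> - W 0 \<omega>) (\<lambda>z. ennreal (mvnormal_density ((T - 0) *\<^sub>R corr_matrix \<rho>) z))"
    if "0 \<le> (0::real) \<and> 0 < T \<and> T \<le> T"
    using W that unfolding wiener_process_def by blast
  have st: "AE \<omega> in M. W 0 \<omega> = 0"
    using W unfolding wiener_process_def by blast
  note D = D[simplified, OF T]
  note P = distributed_vec_pair[OF D]
  have "AE z in lborel. z \<notin> N" using N by (rule AE_not_in)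
  then have "AE z in density lborel (\<lambda>(x, y). ennreal (mvnormal_density (T *\<^sub>R corr_matrix \<rho>) (vector [x, y]))). z \<notin> N"
    using P by (subst AE_density) (auto simp: distributed_def)
  moreover have "distr M lborel (\<lambda>\<omega>. vec_pair (W T \<omega> - W 0 \<omega>))
      = density lborel (\<lambda>(x, y). ennreal (mvnormal_density (T *\<^sub>R corr_matrix \<rho>) (vector [x, y])))"
    and m: "(\<lambda>\<omega>. vec_pair (W T \<omega> - W 0 \<omega>)) \<in> measurable M lborel"
    using P unfolding distributed_def by blast+
  ultimately have "AE z in distr M lborel (\<lambda>\<omega>. vec_pair (W T \<omega> - W 0 \<omega>)). z \<notin> N"
    by argo
  then have "AE \<omega> in M. vec_pair (W T \<omega> - W 0 \<omega>) \<notin> N"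
    using m N by (subst (asm) AE_distr_iff) (auto simp: null_sets_def)
  then show ?thesis
    using st by eventually_elim simp
qed

section \<open>Conditional densities and the spread option\<close>

lemma borel_measurable_pdf[measurable]: "pdf M X \<in> borel_measurable borel"
  unfolding pdf_def[abs_def] by measurable

lemma pdf_nonneg: "0 \<le> pdf M X x"
  by (simp add: pdf_def)

text \<open>\<open>pdf\<close> applies \<open>enn2real\<close> to the Radon-Nikodym derivative. The
  law is finite, hence sigma-finite, so the derivative is finite almost everywhere and nothing is
  lost.\<close>

lemma (in finite_measure) distr_eq_density_pdf:
  assumes X[measurable]: "X \<in> borel_measurable M"
    and ac: "absolutely_continuous lborel (distr M lborel X)"
  shows "distr M lborel X = density lborel (\<lambda>x. ennreal (pdf M X x))"
proof -
  have "finite_measure (distr M lborel X)"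
    by (rule finite_measure_distr) simp
  then have s: "sigma_finite_measure (distr M lborel X)"
    by (simp add: finite_measure_def)
  have "AE x in lborel. RN_deriv lborel (distr M lborel X) x \<noteq> \<infinity>"
    by (rule sigma_finite_measure.RN_deriv_finite[OF sigma_finite_lborel s ac]) simp
  then have ae: "AE x in lborel. RN_deriv lborel (distr M lborel X) x = ennreal (pdf M X x)"
    by eventually_elim (simp add: pdf_def less_top)
  have "distr M lborel X = density lborel (RN_deriv lborel (distr M lborel X))"
    by (rule sigma_finite_measure.density_RN_deriv[symmetric, OF sigma_finite_lborel ac]) simp
  also have "\<dots> = density lborel (\<lambda>x. ennreal (pdf M X x))"
    using ae by (intro density_cong) auto
  finally show ?thesis .
qed

text \<open>Fubini for the joint density. The delicate point is the quotient in
  \<open>cond_pdf\<close>: where the marginal density is 0 the right-hand integrand is 0 as well, so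
  the joint density has to vanish there for almost every x.\<close>

lemma (in finite_measure) integral_cond_pdf:
  fixes X Y :: "'a \<Rightarrow> real" and \<phi> :: "real \<times> real \<Rightarrow> real"
  assumes X[measurable]: "X \<in> borel_measurable M" and Y[measurable]: "Y \<in> borel_measurable M"
    and ac: "absolutely_continuous lborel (distr M lborel (\<lambda>\<omega>. (X \<omega>, Y \<omega>)))"
    and \<phi>[measurable]: "\<phi> \<in> borel_measurable borel"
    and int: "integrable M (\<lambda>\<omega>. \<phi> (X \<omega>, Y \<omega>))"
  shows "(\<integral>\<omega>. \<phi> (X \<omega>, Y \<omega>) \<partial>M) = (LBINT y. (LBINT x. \<phi> (x, y) * cond_pdf M X Y y x) * pdf M Y y)"
proof -
  define f where "f = pdf M (\<lambda>\<omega>. (X \<omega>, Y \<omega>))"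
  define g where "g = pdf M Y"
  have f0: "0 \<le> f z" for z by (simp add: f_def pdf_nonneg)
  have fm[measurable]: "f \<in> borel_measurable borel" and gm[measurable]: "g \<in> borel_measurable borel"
    by (simp_all add: f_def g_def)
  have XY: "(\<lambda>\<omega>. (X \<omega>, Y \<omega>)) \<in> borel_measurable M" by measurable
  have df: "distr M lborel (\<lambda>\<omega>. (X \<omega>, Y \<omega>)) = density lborel (\<lambda>z. ennreal (f z))"
    unfolding f_def using XY ac by (rule distr_eq_density_pdf)
  \<comment> \<open>A null set on the second axis gives a null strip in the plane.\<close>
  have "absolutely_continuous lborel (distr M lborel Y)"
  proof (rule absolutely_continuous_distrI[OF Y])
    fix N :: "real set" assume N: "N \<in> null_sets lborel"
    then have N'[measurable]: "N \<in> sets borel" by auto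
    have "emeasure (lborel :: (real \<times> real) measure) (UNIV \<times> N) = 0"
      using N unfolding lborel_prod[symmetric] by (subst lborel.emeasure_pair_measure_Times) auto
    then have "UNIV \<times> N \<in> null_sets (lborel :: (real \<times> real) measure)"
      by (auto simp: null_sets_def borel_prod[symmetric])
    then have "UNIV \<times> N \<in> null_sets (distr M lborel (\<lambda>\<omega>. (X \<omega>, Y \<omega>)))"
      using ac unfolding absolutely_continuous_def by blast
    then have "AE z in distr M lborel (\<lambda>\<omega>. (X \<omega>, Y \<omega>)). z \<notin> UNIV \<times> N"
      by (rule AE_not_in)
    then show "AE \<omega> in M. Y \<omega> \<notin> N"
      by (subst (asm) AE_distr_iff) (auto simp: borel_prod[symmetric])
  qed
  then have dg: "distr M lborel Y = density lborel (\<lambda>y. ennreal (g y))"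
    unfolding g_def by (intro distr_eq_density_pdf) auto
  have ae: "AE y in lborel. g y = 0 \<longrightarrow> (AE x in lborel. f (x, y) = 0)"
  proof -
    \<comment> \<open>\<open>Y\<close> almost never takes a value in the zero set of its own
      density, so the joint density vanishes almost everywhere on the strip over that set.\<close>
    define N where "N = {y. g y = 0}"
    have N[measurable]: "N \<in> sets borel"
      using measurable_sets[OF gm, of "{0}"] by (simp add: N_def vimage_def)
    have "AE y in density lborel (\<lambda>y. ennreal (g y)). y \<notin> N"
      by (subst AE_density) (auto simp: N_def)
    then have "AE \<omega> in M. Y \<omega> \<notin> N"
      unfolding dg[symmetric] by (subst (asm) AE_distr_iff) auto
    then have "AE z in distr M lborel (\<lambda>\<omega>. (X \<omega>, Y \<omega>)). snd z \<notin> N"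
      by (subst AE_distr_iff) (auto simp: borel_prod[symmetric])
    then have "AE z in lborel. 0 < f z \<longrightarrow> snd z \<notin> N"
      unfolding df by (subst (asm) AE_density) auto
    then have "AE z in (lborel \<Otimes>\<^sub>M lborel). 0 < f z \<longrightarrow> snd z \<notin> N"
      unfolding lborel_prod .
    then have "AE x in lborel. AE y in lborel. 0 < f (x, y) \<longrightarrow> y \<notin> N"
      using lborel_pair.AE_pair by fastforce
    then have "AE y in lborel. AE x in lborel. 0 < f (x, y) \<longrightarrow> y \<notin> N"
    proof (subst (asm) lborel_pair.AE_commute)
      have "{x \<in> space (borel \<Otimes>\<^sub>M borel). 0 < f x} \<in> sets (borel \<Otimes>\<^sub>M borel)"
        using fm unfolding borel_prod by measurable
      moreover have "{x \<in> space (borel \<Otimes>\<^sub>M borel). snd x \<notin> N} \<in> sets (borel \<Otimes>\<^sub>M borel)"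
        by measurable
      ultimately have "{x \<in> space (borel \<Otimes>\<^sub>M borel). 0 < f x \<longrightarrow> snd x \<notin> N} \<in> sets (borel \<Otimes>\<^sub>M borel)"
        by (intro sets.sets_Collect_imp)
      then show "{x \<in> space (lborel \<Otimes>\<^sub>M lborel). 0 < f (fst x, snd x) \<longrightarrow> snd x \<notin> N} \<in> sets (lborel \<Otimes>\<^sub>M lborel)"
        by (simp add: space_pair_measure cong: sets_pair_measure_cong)
    qed
    then show ?thesis
    proof eventually_elim
      case (elim y)
      show ?case
      proof
        assume "g y = 0"
        with elim show "AE x in lborel. f (x, y) = 0"
          by (auto simp: N_def elim!: eventually_mono intro!: antisym f0)
      qed
    qed
  qed
  have int': "integrable lborel (\<lambda>z. f z * \<phi> z)"
  proof -
    have "integrable (distr M lborel (\<lambda>\<omega>. (X \<omega>, Y \<omega>))) \<phi>"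
      using int by (subst integrable_distr_eq) auto
    then show ?thesis
      unfolding df by (subst (asm) integrable_real_density) (auto simp: f0)
  qed
  have "(\<integral>\<omega>. \<phi> (X \<omega>, Y \<omega>) \<partial>M) = (\<integral>z. \<phi> z \<partial>distr M lborel (\<lambda>\<omega>. (X \<omega>, Y \<omega>)))"
    by (subst integral_distr) auto
  also have "\<dots> = (\<integral>z. f z * \<phi> z \<partial>lborel)"
    unfolding df by (subst integral_real_density) (auto simp: f0)
  also have "\<dots> = (LBINT y. LBINT x. f (x, y) * \<phi> (x, y))"
    using int' unfolding lborel_prod[symmetric]
    by (subst lborel_pair.integral_snd) (auto simp: case_prod_beta')
  also have "\<dots> = (LBINT y. (LBINT x. \<phi> (x, y) * cond_pdf M X Y y x) * pdf M Y y)"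
  proof (rule integral_cong_AE)
    have [measurable]: "(\<lambda>(y, x). f (x, y) * \<phi> (x, y)) \<in> borel_measurable (lborel \<Otimes>\<^sub>M lborel)"
      "(\<lambda>(y, x). \<phi> (x, y) * (f (x, y) / g y)) \<in> borel_measurable (lborel \<Otimes>\<^sub>M lborel)"
      using fm \<phi> by (simp_all add: borel_prod[symmetric] measurable_split_conv)
    show "(\<lambda>y. LBINT x. f (x, y) * \<phi> (x, y)) \<in> borel_measurable lborel"
      by (intro lborel.borel_measurable_lebesgue_integral) auto
    have "(\<lambda>y. LBINT x. \<phi> (x, y) * (f (x, y) / g y)) \<in> borel_measurable lborel"
      by (intro lborel.borel_measurable_lebesgue_integral) auto
    then show "(\<lambda>y. (LBINT x. \<phi> (x, y) * cond_pdf M X Y y x) * pdf M Y y) \<in> borel_measurable lborel"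
      by (simp add: cond_pdf_def f_def g_def)
    show "AE y in lborel. (LBINT x. f (x, y) * \<phi> (x, y)) = (LBINT x. \<phi> (x, y) * cond_pdf M X Y y x) * pdf M Y y"
      using ae
    proof eventually_elim
      case (elim y)
      show ?case
      proof (cases "g y = 0")
        case True
        then have "AE x in lborel. f (x, y) * \<phi> (x, y) = 0"
          using elim by (auto elim: eventually_mono)
        then have "(LBINT x. f (x, y) * \<phi> (x, y)) = 0" by (rule integral_eq_zero_AE)
        then show ?thesis using True by (simp add: g_def)
      next
        case False
        have "(\<lambda>x. \<phi> (x, y) * cond_pdf M X Y y x) = (\<lambda>x. f (x, y) * \<phi> (x, y) / g y)"
          by (simp add: cond_pdf_def f_def g_def mult.commute)
        then show ?thesis using False by (simp add: g_def)
      qed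
    qed
  qed
  finally show ?thesis .
qed

lemma (in finite_measure) integral_cond_pdf_set:
  fixes X Y :: "'a \<Rightarrow> real" and k :: "real \<Rightarrow> real \<Rightarrow> real"
  assumes X: "X \<in> borel_measurable M" and Y: "Y \<in> borel_measurable M"
    and ac: "absolutely_continuous lborel (distr M lborel (\<lambda>\<omega>. (X \<omega>, Y \<omega>)))"
    and S: "{z. fst z \<in> S (snd z)} \<in> sets borel"
    and k: "(\<lambda>z. k (fst z) (snd z)) \<in> borel_measurable borel"
    and int: "integrable M (\<lambda>\<omega>. indicator (S (Y \<omega>)) (X \<omega>) * k (X \<omega>) (Y \<omega>))"
  shows "(LBINT y. (LBINT x:S y. k x y * cond_pdf M X Y y x) * pdf M Y y)
    = (\<integral>\<omega>. indicator (S (Y \<omega>)) (X \<omega>) * k (X \<omega>) (Y \<omega>) \<partial>M)"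
proof -
  have "(\<lambda>z. indicator {z. fst z \<in> S (snd z)} z * k (fst z) (snd z)) \<in> borel_measurable borel"
    using S k by (intro borel_measurable_times borel_measurable_indicator)
  moreover have "(\<lambda>z. indicator {z. fst z \<in> S (snd z)} z * k (fst z) (snd z))
      = (\<lambda>z. indicator (S (snd z)) (fst z) * k (fst z) (snd z))"
    by (auto simp: fun_eq_iff indicator_def)
  ultimately have "(\<lambda>z. indicator (S (snd z)) (fst z) * k (fst z) (snd z)) \<in> borel_measurable borel"
    by simp
  from integral_cond_pdf[OF X Y ac this] int show ?thesis
    by (simp add: set_lebesgue_integral_def mult.assoc)
qed

text \<open>What the two measures have in common. It is used with the original noises, drifts
  \<alpha> and constant \<open>B * T\<close>, and under the martingale measure with the shifted
  noises, drift \<open>r\<close> and constant \<open>Bt * T\<close>. The constants \<open>k1\<close>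
  and \<open>k2\<close> absorb initial prices and drifts. The payoff formula is asked for almost
  everywhere only, because the stock equation determines the prices up to null sets.\<close>

locale spread_option = finite_measure P for P :: "'a measure" +
  fixes X Y Z H :: "'a \<Rightarrow> real" and k1 k2 v1 v2 K A1 A2 b :: real and s1 s2 d :: "real \<Rightarrow> real"
  assumes X[measurable]: "X \<in> borel_measurable P" and Y[measurable]: "Y \<in> borel_measurable P"
    and H_meas[measurable]: "H \<in> borel_measurable P"
    and ac: "absolutely_continuous lborel (distr P lborel (\<lambda>\<omega>. (X \<omega>, Y \<omega>)))"
    and exp_int: "\<And>u v. integrable P (\<lambda>\<omega>. exp (u * X \<omega> + v * Y \<omega>))"
    and Z: "Z = (\<lambda>\<omega>. exp (- A1 * X \<omega> - A2 * Y \<omega> - b))"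
    and pos: "0 < k1" "0 < k2" "0 < v1" "0 < K"
    and s1: "s1 = (\<lambda>x. k1 * exp (v1 * x))" and s2: "s2 = (\<lambda>y. k2 * exp (v2 * y))"
    and d: "d = (\<lambda>y. 1 / v1 * ln ((s2 y + K) / k1))"
    and H: "AE \<omega> in P. H \<omega> = max (s1 (X \<omega>) - s2 (Y \<omega>) - K) 0"
begin

lemma s_meas[measurable]: "s1 \<in> borel_measurable borel" "s2 \<in> borel_measurable borel" "d \<in> borel_measurable borel"
  unfolding d s1 s2 by measurable

lemma d_snd_meas: "{z :: real \<times> real. d (snd z) \<le> fst z} \<in> sets (borel \<Otimes>\<^sub>M borel)"
proof -
  have "(\<lambda>z :: real \<times> real. d (snd z)) \<in> borel_measurable (borel \<Otimes>\<^sub>M borel)"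
    by (rule measurable_compose[OF measurable_snd s_meas(3)])
  from borel_measurable_le[OF this measurable_fst] show ?thesis
    by (simp add: space_pair_measure)
qed

lemma s2_pos: "0 < s2 y" using pos by (simp add: s2)

text \<open>\<open>d y\<close> is the exercise threshold: \<open>s1\<close> increases, as
  \<open>v1\<close> is positive, and reaches the level \<open>s2 y + K\<close> at
  \<open>d y\<close>.\<close>

lemma d_le_iff: "d y \<le> x \<longleftrightarrow> s2 y + K \<le> s1 x"
proof -
  have q: "0 < (s2 y + K) / k1" using pos s2_pos[of y] by simp
  have "d y \<le> x \<longleftrightarrow> ln ((s2 y + K) / k1) \<le> v1 * x"
    using pos by (simp add: d field_simps)
  also have "\<dots> \<longleftrightarrow> (s2 y + K) / k1 \<le> exp (v1 * x)"
    using q ln_ge_iff[of "exp (v1 * x)"] by (metis exp_le_cancel_iff exp_ln)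
  also have "\<dots> \<longleftrightarrow> s2 y + K \<le> s1 x"
    using pos by (simp add: s1 field_simps)
  finally show ?thesis .
qed

lemma payoff_eq: "max (s1 x - s2 y - K) 0 = indicator {d y..} x * (s1 x - s2 y - K)"
  using d_le_iff[of y x] by (auto simp: indicator_def)

text \<open>On the exercise region the payoff lies between 0 and \<open>s1\<close>, so powers of
  \<open>s1\<close> dominate the payoff integrands; such a power is an exponential of
  \<open>X\<close>.\<close>

lemma integrable_s1_powr: "integrable P (\<lambda>\<omega>. s1 (X \<omega>) powr p)"
proof -
  have "s1 x powr p = k1 powr p * exp ((p * v1) * x + 0 * y)" for x y
    using pos by (simp add: s1 powr_mult exp_powr_real mult_ac)
  then show ?thesis
    using integrable_mult_right[OF exp_int, of "k1 powr p" "p * v1" 0] by simp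
qed

lemma integrable_s1: "integrable P (\<lambda>\<omega>. s1 (X \<omega>))"
  using integrable_s1_powr[of 1] pos by (simp add: s1)

lemma linear_loss:
  assumes c: "0 \<le> c"
  shows "(\<integral>\<omega>. H \<omega> * indicator {\<omega>. inverse (Z \<omega>) \<ge> c} \<omega> \<partial>P) =
    (LBINT y. (LBINT x:{d y..}. (s1 x - s2 y - K)
            * indicator {x. ereal (A1 * x + A2 * y) \<ge> ln_ext c - ereal b} x
            * cond_pdf P X Y y x) * pdf P Y y)" (is "_ = ?R")
proof -
  \<comment> \<open>The exponential form covers \<open>c = 0\<close> too: the left side is then
    minus infinity and the right condition is trivially true. It is also a condition on reals whose
    measurability is plain.\<close>
  have ln: "ln_ext c - ereal b \<le> ereal e \<longleftrightarrow> c \<le> exp (e + b)" for e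
  proof (cases "c = 0")
    case False
    then have "c \<le> exp (e + b) \<longleftrightarrow> ln c \<le> e + b"
      using c by (metis exp_le_cancel_iff exp_ln less_le)
    then show ?thesis using False by (auto simp: ln_ext_def)
  qed (simp add: ln_ext_def)
  have R: "?R = (LBINT y. (LBINT x:{d y..}. ((s1 x - s2 y - K) * indicator {x. c \<le> exp (A1 * x + A2 * y + b)} x)
            * cond_pdf P X Y y x) * pdf P Y y)"
    by (simp add: ln)
  have "?R = (\<integral>\<omega>. indicator {d (Y \<omega>)..} (X \<omega>) * ((s1 (X \<omega>) - s2 (Y \<omega>) - K)
      * indicator {x. c \<le> exp (A1 * x + A2 * Y \<omega> + b)} (X \<omega>)) \<partial>P)"
    unfolding R
  proof (rule integral_cond_pdf_set[OF X Y ac])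
    show "{z. fst z \<in> {d (snd z)..}} \<in> sets borel"
      using d_snd_meas unfolding borel_prod by simp
    have "{z \<in> space (borel \<Otimes>\<^sub>M borel). c \<le> exp (A1 * fst z + A2 * snd z + b)} \<in> sets (borel \<Otimes>\<^sub>M borel)"
      by measurable
    then have [measurable]: "{z :: real \<times> real. c \<le> exp (A1 * fst z + A2 * snd z + b)} \<in> sets (borel \<Otimes>\<^sub>M borel)"
      by (simp add: space_pair_measure)
    have "(\<lambda>z. (s1 (fst z) - s2 (snd z) - K) * indicator {z. c \<le> exp (A1 * fst z + A2 * snd z + b)} z) \<in> borel_measurable borel"
      by (simp add: borel_prod[symmetric])
    then show "(\<lambda>z. (s1 (fst z) - s2 (snd z) - K) * indicator {x. c \<le> exp (A1 * x + A2 * snd z + b)} (fst z)) \<in> borel_measurable borel"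
      by (simp add: indicator_def)
    show "integrable P (\<lambda>\<omega>. indicator {d (Y \<omega>)..} (X \<omega>) * ((s1 (X \<omega>) - s2 (Y \<omega>) - K)
      * indicator {x. c \<le> exp (A1 * x + A2 * Y \<omega> + b)} (X \<omega>)))"
    proof (rule Bochner_Integration.integrable_bound[OF integrable_s1])
      show "AE \<omega> in P. norm (indicator {d (Y \<omega>)..} (X \<omega>) * ((s1 (X \<omega>) - s2 (Y \<omega>) - K)
        * indicator {x. c \<le> exp (A1 * x + A2 * Y \<omega> + b)} (X \<omega>))) \<le> norm (s1 (X \<omega>))"
      proof (rule AE_I2)
        fix \<omega>
        show "norm (indicator {d (Y \<omega>)..} (X \<omega>) * ((s1 (X \<omega>) - s2 (Y \<omega>) - K)
          * indicator {x. c \<le> exp (A1 * x + A2 * Y \<omega> + b)} (X \<omega>))) \<le> norm (s1 (X \<omega>))"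
          using s2_pos[of "Y \<omega>"] pos by (auto simp: indicator_def d_le_iff)
      qed
    qed (simp add: indicator_def)
  qed
  also have "\<dots> = (\<integral>\<omega>. H \<omega> * indicator {\<omega>. inverse (Z \<omega>) \<ge> c} \<omega> \<partial>P)"
  proof (rule integral_cong_AE)
    have "inverse (Z \<omega>) = exp (A1 * X \<omega> + A2 * Y \<omega> + b)" for \<omega>
      by (simp add: Z exp_minus[symmetric])
    then show "AE \<omega> in P. indicator {d (Y \<omega>)..} (X \<omega>) * ((s1 (X \<omega>) - s2 (Y \<omega>) - K)
      * indicator {x. c \<le> exp (A1 * x + A2 * Y \<omega> + b)} (X \<omega>)) = H \<omega> * indicator {\<omega>. inverse (Z \<omega>) \<ge> c} \<omega>"
      using H by (auto simp: payoff_eq indicator_def elim!: eventually_mono)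
  qed (simp_all add: indicator_def Z)
  finally show ?thesis ..
qed

text \<open>The quantity \<open>(c * Z) powr (1 / (p - 1))\<close> as a function of the noises. The
  part of the claim that \<open>phi_pow\<close> leaves uncovered is the minimum of
  \<open>cap\<close> and the payoff.\<close>

definition cap :: "real \<Rightarrow> real \<Rightarrow> real \<Rightarrow> real \<Rightarrow> real" where
  "cap p c x y = c powr (1 / (p - 1)) * exp (- ((A1 * x + A2 * y + b) / (p - 1)))"

lemma cap_eq: "0 \<le> c \<Longrightarrow> (c * Z \<omega>) powr (1 / (p - 1)) = cap p c (X \<omega>) (Y \<omega>)"
proof -
  assume c: "0 \<le> c"
  have "(- A1 * X \<omega> - A2 * Y \<omega> - b) * (1 / (p - 1)) = - ((A1 * X \<omega> + A2 * Y \<omega> + b) / (p - 1))"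
    by (simp add: divide_simps)
  with c show ?thesis
    by (simp add: cap_def Z powr_mult exp_powr_real)
qed

lemma cap_nonneg: "0 \<le> cap p c x y" by (simp add: cap_def)

text \<open>Isolates the factor depending on \<open>c\<close> and \<open>b\<close> alone, which
  becomes the constant before the second integral of \<open>power_loss2\<close>;
  \<open>cap_powr\<close> does the same for \<open>power_loss1\<close>.\<close>

lemma cap_split: "cap p c x y = c powr (1 / (p - 1)) * exp (- (b / (p - 1))) * exp (- (A1 / (p - 1)) * x - A2 / (p - 1) * y)"
  by (simp add: cap_def add_divide_distrib flip: exp_add)

lemma cap_powr: "cap p c x y powr p
  = c powr (p / (p - 1)) * exp (- (p * b / (p - 1))) * exp (- (p * A1 / (p - 1)) * x - p * A2 / (p - 1) * y)"
proof -
  have e: "- ((A1 * x + A2 * y + b) / (p - 1)) * p = - (p * b / (p - 1)) + (- (p * A1 / (p - 1)) * x - p * A2 / (p - 1) * y)"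
    by (simp add: add_divide_distrib algebra_simps)
  have "cap p c x y powr p = (c powr (1 / (p - 1))) powr p * exp (- ((A1 * x + A2 * y + b) / (p - 1))) powr p"
    unfolding cap_def by (rule powr_mult)
  then show ?thesis
    unfolding powr_powr exp_powr_real e exp_add by (simp add: mult.assoc)
qed

lemma cap_meas[measurable]: "(\<lambda>z. cap p c (fst z) (snd z)) \<in> borel_measurable borel"
  unfolding cap_def by (simp add: borel_prod[symmetric])

lemma cap_XY_meas[measurable]: "(\<lambda>\<omega>. cap p c (X \<omega>) (Y \<omega>)) \<in> borel_measurable P"
  unfolding cap_def by simp

lemma cap_set_meas:
  "{z. d (snd z) \<le> fst z \<and> cap p c (fst z) (snd z) \<le> s1 (fst z) - s2 (snd z) - K} \<in> sets borel"
  "{z. d (snd z) \<le> fst z \<and> s1 (fst z) - s2 (snd z) - K < cap p c (fst z) (snd z)} \<in> sets borel"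
proof -
  have cm: "(\<lambda>z. cap p c (fst z) (snd z)) \<in> borel_measurable (borel \<Otimes>\<^sub>M borel)"
    using cap_meas by (simp add: borel_prod)
  have sd: "(\<lambda>z. s1 (fst z) - s2 (snd z) - K) \<in> borel_measurable (borel \<Otimes>\<^sub>M borel)"
    by measurable
  have "{z. d (snd z) \<le> fst z} \<inter> {z \<in> space (borel \<Otimes>\<^sub>M borel). cap p c (fst z) (snd z) \<le> s1 (fst z) - s2 (snd z) - K}
      \<in> sets (borel \<Otimes>\<^sub>M borel)"
    by (intro sets.Int d_snd_meas borel_measurable_le cm sd)
  then show "{z. d (snd z) \<le> fst z \<and> cap p c (fst z) (snd z) \<le> s1 (fst z) - s2 (snd z) - K} \<in> sets borel"
    unfolding borel_prod by (simp add: Int_def)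
  have "{z. d (snd z) \<le> fst z} \<inter> {z \<in> space (borel \<Otimes>\<^sub>M borel). s1 (fst z) - s2 (snd z) - K < cap p c (fst z) (snd z)}
      \<in> sets (borel \<Otimes>\<^sub>M borel)"
    by (intro sets.Int d_snd_meas borel_measurable_less cm sd)
  then show "{z. d (snd z) \<le> fst z \<and> s1 (fst z) - s2 (snd z) - K < cap p c (fst z) (snd z)} \<in> sets borel"
    unfolding borel_prod by (simp add: Int_def)
qed

lemma s_XY_meas[measurable]: "(\<lambda>\<omega>. s1 (X \<omega>) - s2 (Y \<omega>) - K) \<in> borel_measurable P"
  by measurable

lemma ind_XY_meas:
  "(\<lambda>\<omega>. indicator {x. d (Y \<omega>) \<le> x \<and> cap p c x (Y \<omega>) \<le> s1 x - s2 (Y \<omega>) - K} (X \<omega>) :: real) \<in> borel_measurable P"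
  "(\<lambda>\<omega>. indicator {x. d (Y \<omega>) \<le> x \<and> s1 x - s2 (Y \<omega>) - K < cap p c x (Y \<omega>)} (X \<omega>) :: real) \<in> borel_measurable P"
  by (simp_all add: indicator_def)

text \<open>The uncovered part of the claim is the smaller of payoff and cap. On \<open>SB\<close>
  this is the payoff, on \<open>SA\<close> the cap, from whose p-th power a constant splits off by
  \<open>cap_powr\<close>.\<close>

lemma power_loss1:
  assumes c: "0 \<le> c" and p: "1 < p"
  defines "SA \<equiv> \<lambda>y. {x. d y \<le> x \<and> cap p c x y \<le> s1 x - s2 y - K}"
    and "SB \<equiv> \<lambda>y. {x. d y \<le> x \<and> s1 x - s2 y - K < cap p c x y}"
  shows "Psi1_pow P p Z H c =
     1 / p * (LBINT y. (LBINT x:SB y. (s1 x - s2 y - K) powr p * cond_pdf P X Y y x) * pdf P Y y)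
   + 1 / p * c powr (p / (p - 1)) * exp (- (p * b / (p - 1)))
      * (LBINT y. (LBINT x:SA y. exp (- (p * A1 / (p - 1)) * x - p * A2 / (p - 1) * y)
            * cond_pdf P X Y y x) * pdf P Y y)"
proof -
  define e where "e x y = exp (- (p * A1 / (p - 1)) * x - p * A2 / (p - 1) * y)" for x y
  define C where "C = c powr (p / (p - 1)) * exp (- (p * b / (p - 1)))"
  have indM: "(\<lambda>\<omega>. indicator (SA (Y \<omega>)) (X \<omega>) :: real) \<in> borel_measurable P"
    "(\<lambda>\<omega>. indicator (SB (Y \<omega>)) (X \<omega>) :: real) \<in> borel_measurable P"
    using ind_XY_meas[of p c] by (simp_all add: SA_def SB_def)
  have eM[measurable]: "(\<lambda>\<omega>. e (X \<omega>) (Y \<omega>)) \<in> borel_measurable P"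
    unfolding e_def by measurable
  have pM: "(\<lambda>\<omega>. (s1 (X \<omega>) - s2 (Y \<omega>) - K) powr p) \<in> borel_measurable P"
    by measurable
  have iB: "integrable P (\<lambda>\<omega>. indicator (SB (Y \<omega>)) (X \<omega>) * (s1 (X \<omega>) - s2 (Y \<omega>) - K) powr p)"
  proof (rule Bochner_Integration.integrable_bound[OF integrable_s1_powr[of p]])
    show "AE \<omega> in P. norm (indicator (SB (Y \<omega>)) (X \<omega>) * (s1 (X \<omega>) - s2 (Y \<omega>) - K) powr p) \<le> norm (s1 (X \<omega>) powr p)"
    proof (rule AE_I2)
      fix \<omega>
      show "norm (indicator (SB (Y \<omega>)) (X \<omega>) * (s1 (X \<omega>) - s2 (Y \<omega>) - K) powr p) \<le> norm (s1 (X \<omega>) powr p)"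
        using s2_pos[of "Y \<omega>"] pos p
        by (auto simp: indicator_def SB_def d_le_iff intro!: powr_mono2)
    qed
  qed (intro borel_measurable_times indM pM s_XY_meas)
  have "integrable P (\<lambda>\<omega>. e (X \<omega>) (Y \<omega>))"
    using exp_int[of "- (p * A1 / (p - 1))" "- (p * A2 / (p - 1))"] by (simp add: e_def)
  then have iA: "integrable P (\<lambda>\<omega>. indicator (SA (Y \<omega>)) (X \<omega>) * e (X \<omega>) (Y \<omega>))"
    by (rule Bochner_Integration.integrable_bound)
      (auto simp: indicator_def e_def intro!: AE_I2 borel_measurable_times indM[unfolded indicator_def])
  have B: "(LBINT y. (LBINT x:SB y. (s1 x - s2 y - K) powr p * cond_pdf P X Y y x) * pdf P Y y)
     = (\<integral>\<omega>. indicator (SB (Y \<omega>)) (X \<omega>) * (s1 (X \<omega>) - s2 (Y \<omega>) - K) powr p \<partial>P)"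
    by (rule integral_cond_pdf_set[OF X Y ac _ _ iB])
      (use cap_set_meas(2)[of p c] in \<open>auto simp: SB_def borel_prod[symmetric]\<close>)
  have A: "(LBINT y. (LBINT x:SA y. e x y * cond_pdf P X Y y x) * pdf P Y y)
     = (\<integral>\<omega>. indicator (SA (Y \<omega>)) (X \<omega>) * e (X \<omega>) (Y \<omega>) \<partial>P)"
    by (rule integral_cond_pdf_set[OF X Y ac _ _ iA])
      (use cap_set_meas(1)[of p c] in \<open>auto simp: SA_def e_def borel_prod[symmetric]\<close>)
  have "(\<integral>\<omega>. ((1 - phi_pow p Z H c \<omega>) * H \<omega>) powr p \<partial>P)
    = (\<integral>\<omega>. indicator (SB (Y \<omega>)) (X \<omega>) * (s1 (X \<omega>) - s2 (Y \<omega>) - K) powr p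
        + C * (indicator (SA (Y \<omega>)) (X \<omega>) * e (X \<omega>) (Y \<omega>)) \<partial>P)"
  proof (rule integral_cong_AE)
    show "AE \<omega> in P. ((1 - phi_pow p Z H c \<omega>) * H \<omega>) powr p
      = indicator (SB (Y \<omega>)) (X \<omega>) * (s1 (X \<omega>) - s2 (Y \<omega>) - K) powr p
        + C * (indicator (SA (Y \<omega>)) (X \<omega>) * e (X \<omega>) (Y \<omega>))"
      using H
    proof eventually_elim
      case (elim \<omega>)
      define h where "h = s1 (X \<omega>) - s2 (Y \<omega>) - K"
      define q where "q = cap p c (X \<omega>) (Y \<omega>)"
      have Ce: "C * e (X \<omega>) (Y \<omega>) = q powr p"
        unfolding q_def cap_powr C_def e_def ..
      have q0: "0 \<le> q" unfolding q_def by (rule cap_nonneg)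
      have SA: "X \<omega> \<in> SA (Y \<omega>) \<longleftrightarrow> 0 \<le> h \<and> q \<le> h" and SB: "X \<omega> \<in> SB (Y \<omega>) \<longleftrightarrow> 0 \<le> h \<and> h < q"
        by (auto simp: SA_def SB_def d_le_iff h_def q_def)
      have "((1 - phi_pow p Z H c \<omega>) * H \<omega>) powr p = (if 0 < h then (min q h) powr p else 0)"
      proof (cases "0 < h")
        case True
        then have "(1 - phi_pow p Z H c \<omega>) * H \<omega> = min (q / h) 1 * h"
          using elim by (simp add: phi_pow_def cap_eq[OF c] q_def h_def)
        also have "\<dots> = min q h"
          using True by (auto simp: min_def field_simps)
        finally show ?thesis using True by simp
      next
        case False
        then show ?thesis using elim by (simp add: h_def)
      qed
      \<comment> \<open>At \<open>h = 0\<close> the left side is 0. On the right either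
        \<open>SB\<close> applies with \<open>0 powr p = 0\<close>, or \<open>SA\<close> applies
        with \<open>q = 0\<close>, because \<open>q\<close> is nonnegative.\<close>
      also have "\<dots> = indicator (SB (Y \<omega>)) (X \<omega>) * h powr p + indicator (SA (Y \<omega>)) (X \<omega>) * q powr p"
        using q0 by (auto simp: indicator_def SA SB min_def)
      finally show ?case by (simp add: h_def Ce[symmetric])
    qed
    have [measurable]: "phi_pow p Z H c \<in> borel_measurable P"
      unfolding phi_pow_def[abs_def] cap_eq[OF c] by (simp add: indicator_def)
    show "(\<lambda>\<omega>. ((1 - phi_pow p Z H c \<omega>) * H \<omega>) powr p) \<in> borel_measurable P"
      by measurable
  qed (intro borel_measurable_add borel_measurable_diff borel_measurable_times borel_measurable_const indM pM eM s_XY_meas)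
  also have "\<dots> = (\<integral>\<omega>. indicator (SB (Y \<omega>)) (X \<omega>) * (s1 (X \<omega>) - s2 (Y \<omega>) - K) powr p \<partial>P)
      + C * (\<integral>\<omega>. indicator (SA (Y \<omega>)) (X \<omega>) * e (X \<omega>) (Y \<omega>) \<partial>P)"
    using iA iB by simp
  finally show ?thesis
    unfolding Psi1_pow_def e_def[symmetric] A B by (simp add: C_def distrib_left)
qed

text \<open>The covered part is the payoff minus its minimum with the cap. It is 0 where the cap
  exceeds the payoff, so only \<open>SA\<close> contributes, and there it is payoff minus
  cap.\<close>

lemma power_loss2:
  assumes c: "0 \<le> c" and p: "1 < p"
  defines "SA \<equiv> \<lambda>y. {x. d y \<le> x \<and> cap p c x y \<le> s1 x - s2 y - K}"
  shows "Psi2_pow P p Z H c =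
     (LBINT y. (LBINT x:SA y. (s1 x - s2 y - K) * cond_pdf P X Y y x) * pdf P Y y)
   - c powr (1 / (p - 1)) * exp (- (b / (p - 1)))
      * (LBINT y. (LBINT x:SA y. exp (- (A1 / (p - 1)) * x - A2 / (p - 1) * y)
            * cond_pdf P X Y y x) * pdf P Y y)"
proof -
  define e where "e x y = exp (- (A1 / (p - 1)) * x - A2 / (p - 1) * y)" for x y
  define C where "C = c powr (1 / (p - 1)) * exp (- (b / (p - 1)))"
  have indM: "(\<lambda>\<omega>. indicator (SA (Y \<omega>)) (X \<omega>) :: real) \<in> borel_measurable P"
    using ind_XY_meas(1)[of p c] by (simp add: SA_def)
  have eM[measurable]: "(\<lambda>\<omega>. e (X \<omega>) (Y \<omega>)) \<in> borel_measurable P"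
    unfolding e_def by measurable
  have iH: "integrable P (\<lambda>\<omega>. indicator (SA (Y \<omega>)) (X \<omega>) * (s1 (X \<omega>) - s2 (Y \<omega>) - K))"
  proof (rule Bochner_Integration.integrable_bound[OF integrable_s1])
    show "AE \<omega> in P. norm (indicator (SA (Y \<omega>)) (X \<omega>) * (s1 (X \<omega>) - s2 (Y \<omega>) - K)) \<le> norm (s1 (X \<omega>))"
    proof (rule AE_I2)
      fix \<omega>
      show "norm (indicator (SA (Y \<omega>)) (X \<omega>) * (s1 (X \<omega>) - s2 (Y \<omega>) - K)) \<le> norm (s1 (X \<omega>))"
        using s2_pos[of "Y \<omega>"] pos by (auto simp: indicator_def SA_def d_le_iff)
    qed
  qed (intro borel_measurable_times indM s_XY_meas)
  have "integrable P (\<lambda>\<omega>. e (X \<omega>) (Y \<omega>))"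
    using exp_int[of "- (A1 / (p - 1))" "- (A2 / (p - 1))"] by (simp add: e_def)
  then have iA: "integrable P (\<lambda>\<omega>. indicator (SA (Y \<omega>)) (X \<omega>) * e (X \<omega>) (Y \<omega>))"
    by (rule Bochner_Integration.integrable_bound)
      (auto simp: indicator_def e_def intro!: AE_I2 borel_measurable_times indM[unfolded indicator_def])
  have H': "(LBINT y. (LBINT x:SA y. (s1 x - s2 y - K) * cond_pdf P X Y y x) * pdf P Y y)
     = (\<integral>\<omega>. indicator (SA (Y \<omega>)) (X \<omega>) * (s1 (X \<omega>) - s2 (Y \<omega>) - K) \<partial>P)"
    by (rule integral_cond_pdf_set[OF X Y ac _ _ iH])
      (use cap_set_meas(1)[of p c] in \<open>auto simp: SA_def borel_prod[symmetric]\<close>)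
  have A: "(LBINT y. (LBINT x:SA y. e x y * cond_pdf P X Y y x) * pdf P Y y)
     = (\<integral>\<omega>. indicator (SA (Y \<omega>)) (X \<omega>) * e (X \<omega>) (Y \<omega>) \<partial>P)"
    by (rule integral_cond_pdf_set[OF X Y ac _ _ iA])
      (use cap_set_meas(1)[of p c] in \<open>auto simp: SA_def e_def borel_prod[symmetric]\<close>)
  have "(\<integral>\<omega>. H \<omega> * phi_pow p Z H c \<omega> \<partial>P)
    = (\<integral>\<omega>. indicator (SA (Y \<omega>)) (X \<omega>) * (s1 (X \<omega>) - s2 (Y \<omega>) - K)
        - C * (indicator (SA (Y \<omega>)) (X \<omega>) * e (X \<omega>) (Y \<omega>)) \<partial>P)"
  proof (rule integral_cong_AE)
    show "AE \<omega> in P. H \<omega> * phi_pow p Z H c \<omega>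
      = indicator (SA (Y \<omega>)) (X \<omega>) * (s1 (X \<omega>) - s2 (Y \<omega>) - K)
        - C * (indicator (SA (Y \<omega>)) (X \<omega>) * e (X \<omega>) (Y \<omega>))"
      using H
    proof eventually_elim
      case (elim \<omega>)
      define h where "h = s1 (X \<omega>) - s2 (Y \<omega>) - K"
      define q where "q = cap p c (X \<omega>) (Y \<omega>)"
      have Ce: "C * e (X \<omega>) (Y \<omega>) = q"
        unfolding q_def cap_split C_def e_def ..
      have q0: "0 \<le> q" unfolding q_def by (rule cap_nonneg)
      have SA: "X \<omega> \<in> SA (Y \<omega>) \<longleftrightarrow> 0 \<le> h \<and> q \<le> h"
        by (auto simp: SA_def d_le_iff h_def q_def)
      have "H \<omega> * phi_pow p Z H c \<omega> = (if 0 < h then h - min q h else 0)"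
      proof (cases "0 < h")
        case True
        then have "H \<omega> * phi_pow p Z H c \<omega> = h * (1 - min (q / h) 1)"
          using elim by (simp add: phi_pow_def cap_eq[OF c] q_def h_def)
        also have "\<dots> = h - min q h"
          using True by (auto simp: min_def field_simps)
        finally show ?thesis using True by simp
      next
        case False
        then show ?thesis using elim by (simp add: h_def)
      qed
      \<comment> \<open>At \<open>h = 0\<close> membership in \<open>SA\<close> forces
        \<open>q = 0\<close>, so the boundary contributes nothing.\<close>
      also have "\<dots> = indicator (SA (Y \<omega>)) (X \<omega>) * h - indicator (SA (Y \<omega>)) (X \<omega>) * q"
        using q0 by (auto simp: indicator_def SA min_def)
      finally show ?case by (simp add: h_def Ce[symmetric])
    qed
    have [measurable]: "phi_pow p Z H c \<in> borel_measurable P"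
      unfolding phi_pow_def[abs_def] cap_eq[OF c] by (simp add: indicator_def)
    show "(\<lambda>\<omega>. H \<omega> * phi_pow p Z H c \<omega>) \<in> borel_measurable P"
      by measurable
  qed (intro borel_measurable_add borel_measurable_diff borel_measurable_times borel_measurable_const indM eM s_XY_meas)
  also have "\<dots> = (\<integral>\<omega>. indicator (SA (Y \<omega>)) (X \<omega>) * (s1 (X \<omega>) - s2 (Y \<omega>) - K) \<partial>P)
      - C * (\<integral>\<omega>. indicator (SA (Y \<omega>)) (X \<omega>) * e (X \<omega>) (Y \<omega>) \<partial>P)"
    using iA iH by simp
  finally show ?thesis
    unfolding Psi2_pow_def e_def[symmetric] A H' by (simp add: C_def)
qed

end

lemma null_sets_lborel_shift:
  fixes c :: "'a::euclidean_space"
  assumes N: "N \<in> null_sets lborel"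
  shows "(+) c -` N \<in> null_sets lborel"
proof -
  have "N \<in> null_sets (distr lborel borel ((+) c))"
    using N by (simp only: lborel_distr_plus)
  then show ?thesis
    by (subst (asm) null_sets_distr_iff) auto
qed

theorem mainTheorem8:
  fixes M :: "'a measure" and F :: "real \<Rightarrow> 'a measure"
    and T \<rho> r K B Bt :: real
    and Q :: "real^2^2"
    and \<alpha> \<sigma> S0 \<theta> A :: "real^2"
    and W :: "real \<Rightarrow> 'a \<Rightarrow> real^2" and S :: "2 \<Rightarrow> real \<Rightarrow> 'a \<Rightarrow> real"
    and W1 W2 Wt1 Wt2 Z H :: "'a \<Rightarrow> real" and Pt :: "'a measure"
    and s1 s2 st1 st2 d dt :: "real \<Rightarrow> real"
    and setA setB setAt :: "real \<Rightarrow> real \<Rightarrow> real \<Rightarrow> real set"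
  assumes T: "T > 0" and rho: "\<bar>\<rho>\<bar> < 1" and K: "K > 0"
    and sigma: "\<And>i. \<sigma> $ i > 0" and S0: "\<And>i. S0 $ i > 0"
    and Q: "Q = corr_matrix \<rho>"
    and M: "prob_space M" and F: "sub_filtration M F"
    and W: "wiener_process M F T Q W"
    and S: "\<And>i. black_scholes_stock M F T (\<alpha> $ i) (\<sigma> $ i) (S0 $ i) (\<lambda>t \<omega>. W t \<omega> $ i) (S i)"
    and theta: "\<theta> = (\<chi> i. (\<alpha> $ i - r) / \<sigma> $ i)"
    and A: "A = matrix_inv Q *v \<theta>"
    and B: "B = 1 / 2 * (norm (psd_sqrt (matrix_inv Q) *v \<theta>))\<^sup>2"
    and Bt: "Bt = B - A $ 1 * \<theta> $ 1 - A $ 2 * \<theta> $ 2"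
    and W1: "W1 = (\<lambda>\<omega>. W T \<omega> $ 1)" and W2: "W2 = (\<lambda>\<omega>. W T \<omega> $ 2)"
    and Wt1: "Wt1 = (\<lambda>\<omega>. W1 \<omega> + \<theta> $ 1 * T)" and Wt2: "Wt2 = (\<lambda>\<omega>. W2 \<omega> + \<theta> $ 2 * T)"
    and Z: "Z = (\<lambda>\<omega>. exp (- A $ 1 * W1 \<omega> - A $ 2 * W2 \<omega> - B * T))"
    and Pt: "Pt = density M (\<lambda>\<omega>. ennreal (Z \<omega>))"
    and H: "H = (\<lambda>\<omega>. max (S 1 T \<omega> - S 2 T \<omega> - K) 0)"
    and s1: "s1 = (\<lambda>x. S0 $ 1 * exp ((\<alpha> $ 1 - 1 / 2 * (\<sigma> $ 1)\<^sup>2) * T + \<sigma> $ 1 * x))"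
    and s2: "s2 = (\<lambda>y. S0 $ 2 * exp ((\<alpha> $ 2 - 1 / 2 * (\<sigma> $ 2)\<^sup>2) * T + \<sigma> $ 2 * y))"
    and st1: "st1 = (\<lambda>x. S0 $ 1 * exp ((r - 1 / 2 * (\<sigma> $ 1)\<^sup>2) * T + \<sigma> $ 1 * x))"
    and st2: "st2 = (\<lambda>y. S0 $ 2 * exp ((r - 1 / 2 * (\<sigma> $ 2)\<^sup>2) * T + \<sigma> $ 2 * y))"
    and d: "d = (\<lambda>y. 1 / \<sigma> $ 1 *
      ln ((s2 y + K) / (S0 $ 1 * exp ((\<alpha> $ 1 - 1 / 2 * (\<sigma> $ 1)\<^sup>2) * T))))"
    and dt: "dt = (\<lambda>y. 1 / \<sigma> $ 1 *
      ln ((st2 y + K) / (S0 $ 1 * exp ((r - 1 / 2 * (\<sigma> $ 1)\<^sup>2) * T))))"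
    and setA: "setA = (\<lambda>p c y. {x. x \<ge> d y \<and>
      c powr (1 / (p - 1)) * exp (- ((A $ 1 * x + A $ 2 * y + B * T) / (p - 1))) \<le> s1 x - s2 y - K})"
    and setB: "setB = (\<lambda>p c y. {x. x \<ge> d y \<and>
      c powr (1 / (p - 1)) * exp (- ((A $ 1 * x + A $ 2 * y + B * T) / (p - 1))) > s1 x - s2 y - K})"
    and setAt: "setAt = (\<lambda>p c y. {x. x \<ge> dt y \<and>
      c powr (1 / (p - 1)) * exp (- ((A $ 1 * x + A $ 2 * y + Bt * T) / (p - 1))) \<le> st1 x - st2 y - K})"
  shows
    "(\<forall>c\<ge>0.
       Psi1_lin M Z H c =
         (LBINT y. (LBINT x:{d y..}. (s1 x - s2 y - K)
            * indicator {x. ereal (A $ 1 * x + A $ 2 * y) \<ge> ln_ext c - ereal (B * T)} x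
            * cond_pdf M W1 W2 y x) * pdf M W2 y) \<and>
       Psi2_lin Pt Z H c =
         (LBINT y. (LBINT x:{dt y..}. (st1 x - st2 y - K)
            * indicator {x. ereal (A $ 1 * x + A $ 2 * y) \<ge> ln_ext c - ereal (Bt * T)} x
            * cond_pdf Pt Wt1 Wt2 y x) * pdf Pt Wt2 y)) \<and>
     (\<forall>p>1. \<forall>c\<ge>0.
       Psi1_pow M p Z H c =
         1 / p * (LBINT y. (LBINT x:setB p c y. (s1 x - s2 y - K) powr p
            * cond_pdf M W1 W2 y x) * pdf M W2 y)
         + 1 / p * c powr (p / (p - 1)) * exp (- (p * B * T / (p - 1)))
           * (LBINT y. (LBINT x:setA p c y. exp (- (p * A $ 1 / (p - 1)) * x - p * A $ 2 / (p - 1) * y)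
            * cond_pdf M W1 W2 y x) * pdf M W2 y) \<and>
       Psi2_pow Pt p Z H c =
         (LBINT y. (LBINT x:setAt p c y. (st1 x - st2 y - K)
            * cond_pdf Pt Wt1 Wt2 y x) * pdf Pt Wt2 y)
         - c powr (1 / (p - 1)) * exp (- (Bt * T / (p - 1)))
           * (LBINT y. (LBINT x:setAt p c y. exp (- (A $ 1 / (p - 1)) * x - A $ 2 / (p - 1) * y)
            * cond_pdf Pt Wt1 Wt2 y x) * pdf Pt Wt2 y))"
proof -
  interpret prob_space M by (rule M)
  have sw: "scalar_wiener M F T (\<lambda>t \<omega>. W t \<omega> $ i)" for i
    using scalar_wiener_component[OF M F rho] W Q by simp
  have S_eq: "AE \<omega> in M. S i T \<omega> = S0 $ i * exp ((\<alpha> $ i - (\<sigma> $ i)\<^sup>2 / 2) * T + \<sigma> $ i * W T \<omega> $ i)" for i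
    by (rule scalar_wiener.stock_eq_geom[OF sw S T])
  have S_M: "S i T \<in> borel_measurable M" for i
    using scalar_wiener.stock_M(2)[OF sw S, of T i] T by simp
  have W_M: "(\<lambda>\<omega>. W T \<omega> $ i) \<in> borel_measurable M" for i
    using scalar_wiener.V_M[OF sw, of T] T by simp
  have W1_M[measurable]: "W1 \<in> borel_measurable M" and W2_M[measurable]: "W2 \<in> borel_measurable M"
    unfolding W1 W2 by (rule W_M)+
  have Z_M[measurable]: "Z \<in> borel_measurable M" unfolding Z by measurable
  have H_M[measurable]: "H \<in> borel_measurable M"
    unfolding H by (intro borel_measurable_max borel_measurable_diff borel_measurable_const S_M)
  have null: "AE \<omega> in M. (W1 \<omega>, W2 \<omega>) \<notin> N" if "N \<in> null_sets lborel" for N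
    using wiener_not_in_null_set[OF W[unfolded Q] T that] by (simp add: W1 W2)
  \<comment> \<open>With \<open>a = u\<^sup>2 / 2\<close> and \<open>s = u\<close> the deterministic
    part of the exponent of \<open>geom\<close> cancels, leaving the exponential of u times the
    coordinate. The joint exponential moment is then an integral of a product of two square
    integrable factors.\<close>
  have sq: "integrable M (\<lambda>\<omega>. (exp (u * W T \<omega> $ i))\<^sup>2)" for u i
    using scalar_wiener.integrable_geom2[OF sw, of T i 1 "u\<^sup>2 / 2" u] T
    by (simp add: scalar_wiener.geom_def[OF sw])
  have exp_int: "integrable M (\<lambda>\<omega>. exp (u * W1 \<omega> + v * W2 \<omega>))" for u v
    using square_integrable_mult[OF sq[of u 1] sq[of v 2]] W_M
    by (simp add: W1 W2 exp_add)
  have Z_pos: "0 < Z \<omega>" for \<omega> by (simp add: Z)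
  have Zt: "Z = (\<lambda>\<omega>. exp (- A $ 1 * Wt1 \<omega> - A $ 2 * Wt2 \<omega> - Bt * T))"
    by (simp add: Z Wt1 Wt2 Bt algebra_simps)
  \<comment> \<open>This is what trades the drift \<alpha> for \<open>r\<close>: shifting the noise
    by \<open>\<theta> $ i * T\<close> absorbs the excess return
    \<open>\<sigma> $ i * \<theta> $ i\<close>.\<close>
  have th: "\<alpha> $ i = r + \<sigma> $ i * \<theta> $ i" for i
    using sigma[of i] by (simp add: theta)
  define k where "k i a = S0 $ i * exp ((a - 1 / 2 * (\<sigma> $ i)\<^sup>2) * T)" for i a
  have s_k: "S0 $ i * exp ((a - 1 / 2 * (\<sigma> $ i)\<^sup>2) * T + \<sigma> $ i * x) = k i a * exp (\<sigma> $ i * x)" for i a x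
    by (simp add: k_def exp_add)
  have k_pos: "0 < k i a" for i a using S0 by (simp add: k_def)

  interpret m: spread_option M W1 W2 Z H "k 1 (\<alpha> $ 1)" "k 2 (\<alpha> $ 2)" "\<sigma> $ 1" "\<sigma> $ 2" K "A $ 1" "A $ 2" "B * T" s1 s2 d
  proof
    show "absolutely_continuous lborel (distr M lborel (\<lambda>\<omega>. (W1 \<omega>, W2 \<omega>)))"
      by (rule absolutely_continuous_distrI) (use null in auto)
    show "AE \<omega> in M. H \<omega> = max (s1 (W1 \<omega>) - s2 (W2 \<omega>) - K) 0"
      using S_eq[of 1] S_eq[of 2] by eventually_elim (simp add: H s1 s2 W1 W2)
    show "Z = (\<lambda>\<omega>. exp (- A $ 1 * W1 \<omega> - A $ 2 * W2 \<omega> - B * T))" by (rule Z)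
    show "s1 = (\<lambda>x. k 1 (\<alpha> $ 1) * exp (\<sigma> $ 1 * x))" "s2 = (\<lambda>y. k 2 (\<alpha> $ 2) * exp (\<sigma> $ 2 * y))"
      unfolding s1 s2 s_k by (rule refl)+
    show "d = (\<lambda>y. 1 / \<sigma> $ 1 * ln ((s2 y + K) / k 1 (\<alpha> $ 1)))"
      unfolding d k_def by (rule refl)
  qed (use exp_int k_pos sigma K in auto)

  have Pt_int: "integrable Pt g \<longleftrightarrow> integrable M (\<lambda>\<omega>. Z \<omega> * g \<omega>)" if "g \<in> borel_measurable M" for g :: "'a \<Rightarrow> real"
    unfolding Pt by (rule integrable_real_density) (use that Z_pos less_imp_le in auto)
  have Pt_M: "borel_measurable Pt = borel_measurable M"
    unfolding Pt by (rule measurable_cong_sets) auto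
  have AE_Pt: "AE \<omega> in Pt. R \<omega>" if "AE \<omega> in M. R \<omega>" for R
    unfolding Pt by (subst AE_density) (use that in \<open>auto elim: eventually_mono\<close>)
  have Wt_M[measurable]: "Wt1 \<in> borel_measurable M" "Wt2 \<in> borel_measurable M"
    unfolding Wt1 Wt2 by measurable
  \<comment> \<open>The density lowers the coefficients \<open>u\<close> and \<open>v\<close> by
    \<open>A $ 1\<close> and \<open>A $ 2\<close>, so an exponential moment under \<open>Pt\<close>
    is a constant times one under \<open>M\<close>.\<close>
  have Z_eq: "Z \<omega> * exp (u * Wt1 \<omega> + v * Wt2 \<omega>) = exp (u * \<theta> $ 1 * T + v * \<theta> $ 2 * T - B * T)
      * exp ((u - A $ 1) * W1 \<omega> + (v - A $ 2) * W2 \<omega>)" for u v \<omega>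
    by (simp add: Z Wt1 Wt2 algebra_simps flip: exp_add)
  have exp_int_t: "integrable Pt (\<lambda>\<omega>. exp (u * Wt1 \<omega> + v * Wt2 \<omega>))" for u v
    by (subst Pt_int) (simp_all add: Z_eq exp_int)

  interpret pt: finite_measure Pt
  proof (rule finite_measureI)
    have "integrable Pt (\<lambda>_. 1 :: real)"
      using exp_int_t[of 0 0] by simp
    then show "emeasure Pt (space Pt) \<noteq> \<infinity>"
      by (simp add: integrable_iff_bounded less_top)
  qed
  interpret t: spread_option Pt Wt1 Wt2 Z H "k 1 r" "k 2 r" "\<sigma> $ 1" "\<sigma> $ 2" K "A $ 1" "A $ 2" "Bt * T" st1 st2 dt
  proof
    show "absolutely_continuous lborel (distr Pt lborel (\<lambda>\<omega>. (Wt1 \<omega>, Wt2 \<omega>)))"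
    proof (rule absolutely_continuous_distrI)
      fix N :: "(real \<times> real) set" assume "N \<in> null_sets lborel"
      \<comment> \<open>The shifted noises lie in \<open>N\<close> exactly when the original ones
        lie in a translate of \<open>N\<close>, again a null set; the density then carries the
        almost sure statement to \<open>Pt\<close>.\<close>
      from null[OF null_sets_lborel_shift[OF this, of "(\<theta> $ 1 * T, \<theta> $ 2 * T)"]]
      have "AE \<omega> in M. (Wt1 \<omega>, Wt2 \<omega>) \<notin> N"
        by (simp add: Wt1 Wt2 add.commute)
      then show "AE \<omega> in Pt. (Wt1 \<omega>, Wt2 \<omega>) \<notin> N" by (rule AE_Pt)
    qed (simp add: Pt_M)
    have "AE \<omega> in M. H \<omega> = max (st1 (Wt1 \<omega>) - st2 (Wt2 \<omega>) - K) 0"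
      using S_eq[of 1] S_eq[of 2]
    proof eventually_elim
      case (elim \<omega>)
      have "S 1 T \<omega> = st1 (Wt1 \<omega>)" "S 2 T \<omega> = st2 (Wt2 \<omega>)"
        unfolding elim st1 st2 Wt1 Wt2 W1 W2 th by (simp_all add: algebra_simps)
      then show ?case by (simp add: H)
    qed
    then show "AE \<omega> in Pt. H \<omega> = max (st1 (Wt1 \<omega>) - st2 (Wt2 \<omega>) - K) 0" by (rule AE_Pt)
    show "Z = (\<lambda>\<omega>. exp (- A $ 1 * Wt1 \<omega> - A $ 2 * Wt2 \<omega> - Bt * T))" by (rule Zt)
    show "st1 = (\<lambda>x. k 1 r * exp (\<sigma> $ 1 * x))" "st2 = (\<lambda>y. k 2 r * exp (\<sigma> $ 2 * y))"
      unfolding st1 st2 s_k by (rule refl)+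
    show "dt = (\<lambda>y. 1 / \<sigma> $ 1 * ln ((st2 y + K) / k 1 r))"
      unfolding dt k_def by (rule refl)
  qed (use exp_int_t k_pos sigma K in \<open>auto simp: Pt_M\<close>)

  show ?thesis
  proof (intro conjI allI impI)
    fix c :: real assume c: "0 \<le> c"
    show "Psi1_lin M Z H c = (LBINT y. (LBINT x:{d y..}. (s1 x - s2 y - K)
            * indicator {x. ereal (A $ 1 * x + A $ 2 * y) \<ge> ln_ext c - ereal (B * T)} x
            * cond_pdf M W1 W2 y x) * pdf M W2 y)"
      unfolding Psi1_lin_def by (rule m.linear_loss[OF c])
    show "Psi2_lin Pt Z H c = (LBINT y. (LBINT x:{dt y..}. (st1 x - st2 y - K)
            * indicator {x. ereal (A $ 1 * x + A $ 2 * y) \<ge> ln_ext c - ereal (Bt * T)} x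
            * cond_pdf Pt Wt1 Wt2 y x) * pdf Pt Wt2 y)"
      unfolding Psi2_lin_def by (rule t.linear_loss[OF c])
  next
    fix p c :: real assume p: "1 < p" and c: "0 \<le> c"
    show "Psi1_pow M p Z H c =
         1 / p * (LBINT y. (LBINT x:setB p c y. (s1 x - s2 y - K) powr p
            * cond_pdf M W1 W2 y x) * pdf M W2 y)
         + 1 / p * c powr (p / (p - 1)) * exp (- (p * B * T / (p - 1)))
           * (LBINT y. (LBINT x:setA p c y. exp (- (p * A $ 1 / (p - 1)) * x - p * A $ 2 / (p - 1) * y)
            * cond_pdf M W1 W2 y x) * pdf M W2 y)"
      using m.power_loss1[OF c p] unfolding setA setB m.cap_def mult.assoc[of p B T] .
    show "Psi2_pow Pt p Z H c =
         (LBINT y. (LBINT x:setAt p c y. (st1 x - st2 y - K)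
            * cond_pdf Pt Wt1 Wt2 y x) * pdf Pt Wt2 y)
         - c powr (1 / (p - 1)) * exp (- (Bt * T / (p - 1)))
           * (LBINT y. (LBINT x:setAt p c y. exp (- (A $ 1 / (p - 1)) * x - A $ 2 / (p - 1) * y)
            * cond_pdf Pt Wt1 Wt2 y x) * pdf Pt Wt2 y)"
      using t.power_loss2[OF c p] unfolding setAt t.cap_def .
  qed
qed

end
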